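(* Let $q$ be a complex number with $0<|q|<1$ and let $a,b,c,d$ be nonzero complex numbers. Let $\varepsilon_b,\varepsilon_c,\varepsilon_d,\varepsilon_e,\lambda_b,\lambda_c,\lambda_d,\lambda_e$ be nonnegative integers with $\Lambda:=\lambda_b+\lambda_c+\lambda_d+\lambda_e\ge 1$ such that, with $\langle n\rangle_x:=\left\lfloor\frac{\varepsilon_x+n\lambda_x}{\Lambda}\right\rfloor$ for $x\in\{b,c,d,e\}$, one has $n=\langle n\rangle_b+\langle n\rangle_c+\langle n\rangle_d+\langle n\rangle_e$ for all integers $n\ge0$. Let $\phi(x;n)$, $H(n)$ and $\Theta(m)$ be as defined in the context. Assume that $\phi(q^n;k)\neq0$ for all integers $n\ge 0$ and $0\le k\le n+1$, that all other denominators occurring below are nonzero, and that the series converges. Then for every integer $\delta$ with $0\le\delta<\Lambda$, $$\frac{(b;q)_\infty(c;q)_\infty(d;q)_\infty(qa^2/bcd;q)_\infty}{(qa/b;q)_\infty(qa/c;q)_\infty(qa/d;q)_\infty(bcd/a;q)_\infty} =\sum_{k=0}^{\delta-1}\Theta(k+1)\left\{\frac{\phi(q^k;k+1)}{-\phi(q^k;k)}\right\}H(k)$$ $$+\sum_{n=0}^{\infty}H(n\Lambda)\,\Theta(n\Lambda)\sum_{i=\delta}^{\delta-1+\Lambda}\frac{\Theta(1+i+n\Lambda)}{\Theta(n\Lambda)}\left\{\frac{\phi(q^{i+n\Lambda};1+i+n\Lambda)}{-\phi(q^{i+n\Lambda};i+n\Lambda)}\right\}\frac{H(i+n\Lamb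da)}{H(n\Lambda)}.$$
   Context: $(x;q)_0=1$, $(x;q)_n=\prod_{j=0}^{n-1}(1-q^jx)$ for $n\ge1$, and $(x;q)_\infty=\prod_{j\ge0}(1-q^jx)$. Expressions such as $a/bc$ mean $a/(bc)$ and $b/ax$ means $b/(ax)$; $\binom m2=m(m-1)/2$; empty sums are $0$. Define $$\phi(x;n)=(bx;q)_{\langle n\rangle_b}(cx;q)_{\langle n\rangle_c}(dx;q)_{\langle n\rangle_d}(qa^2x/bcd;q)_{\langle n\rangle_e}\,(b/ax;q)_{\langle n\rangle_b}(c/ax;q)_{\langle n\rangle_c}(d/ax;q)_{\langle n\rangle_d}(qa/bcdx;q)_{\langle n\rangle_e},$$ $$H(n)=\frac{(b;q)_{\langle n\rangle_b}(c;q)_{\langle n\rangle_c}(d;q)_{\langle n\rangle_d}(qa^2/bcd;q)_{\langle n\rangle_e}}{(q;q)_n\,(bcd/a;q)_{\langle n\rangle_b+\langle n\rangle_c+\langle n\rangle_d}} \cdot\frac{(bc/a;q)_{\langle n\rangle_b+\langle n\rangle_c}(qa/bc;q)_{\langle n\rangle_d+\langle n\rangle_e}}{(qa/b;q)_{\langle n\rangle_c+\langle n\rangle_d+\langle n\rangle_e}}$$ $$\times\frac{(bd/a;q)_{\langle n\rangle_b+\langle n\rangle_d}(qa/bd;q)_{\langle n\rangle_c+\langle n\rangle_e}}{(qa/c;q)_{\langle n\rangle_b+\langle n\rangle_d+\langle n\rangle_e}} \cdot\frac{(cd/a;q)_{\langle n\rangle_c+\langle n\rangle_d}(qa/cd;q)_{\langle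 n\rangle_b+\langle n\rangle_e}}{(qa/d;q)_{\langle n\rangle_b+\langle n\rangle_c+\langle n\rangle_e}},$$ $$\Theta(m)=q^{\binom m2-\binom{\langle m\rangle_b}2-\binom{\langle m\rangle_c}2-\binom{\langle m\rangle_d}2-\binom{\langle m\rangle_e}2}\left(\frac ab\right)^{\langle m\rangle_b}\left(\frac ac\right)^{\langle m\rangle_c}\left(\frac ad\right)^{\langle m\rangle_d}\left(\frac{bcd}{qa}\right)^{\langle m\rangle_e}.$$
   Formalization: "The series converges" is taken as convergence of the underlying term-by-term series over k, not only of the series grouped in blocks of Λ; with grouped convergence alone the claim fails, e.g. λ=(2,0,0,0), ε=0, a/b=−1, where δ=0 and δ=1 give different sums. *)

theory Defs
  imports "HOL-Analysis.Analysis"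
begin

definition qpoch :: "complex \<Rightarrow> complex \<Rightarrow> nat \<Rightarrow> complex" where
  "qpoch q x n = (\<Prod>j<n. 1 - q ^ j * x)"

definition qpoch_inf :: "complex \<Rightarrow> complex \<Rightarrow> complex" where
  "qpoch_inf q x = (\<Prod>j. 1 - q ^ j * x)"

text \<open>Natural number division is the floor of the rational quotient.\<close>

definition bracket :: "nat \<Rightarrow> nat \<Rightarrow> nat \<Rightarrow> nat \<Rightarrow> nat" where
  "bracket ep lam L n = (ep + n * lam) div L"

text \<open>In the next three definitions, \<open>nb\<close>, \<open>nc\<close>, \<open>nd\<close>, \<open>ne\<close> are the four index
  sequences; they are instantiated with \<^const>\<open>bracket\<close>.\<close>

definition phi :: "complex \<Rightarrow> complex \<Rightarrow> complex \<Rightarrow> complex \<Rightarrow> complex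
    \<Rightarrow> (nat \<Rightarrow> nat) \<Rightarrow> (nat \<Rightarrow> nat) \<Rightarrow> (nat \<Rightarrow> nat) \<Rightarrow> (nat \<Rightarrow> nat)
    \<Rightarrow> complex \<Rightarrow> nat \<Rightarrow> complex" where
  "phi q a b c d nb nc nd ne x n =
     qpoch q (b * x) (nb n) * qpoch q (c * x) (nc n) * qpoch q (d * x) (nd n)
     * qpoch q (q * a\<^sup>2 * x / (b * c * d)) (ne n)
     * qpoch q (b / (a * x)) (nb n) * qpoch q (c / (a * x)) (nc n) * qpoch q (d / (a * x)) (nd n)
     * qpoch q (q * a / (b * c * d * x)) (ne n)"

definition H_fun :: "complex \<Rightarrow> complex \<Rightarrow> complex \<Rightarrow> complex \<Rightarrow> complex
    \<Rightarrow> (nat \<Rightarrow> nat) \<Rightarrow> (nat \<Rightarrow> nat) \<Rightarrow> (nat \<Rightarrow> nat) \<Rightarrow> (nat \<Rightarrow> nat)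
    \<Rightarrow> nat \<Rightarrow> complex" where
  "H_fun q a b c d nb nc nd ne n =
     (qpoch q b (nb n) * qpoch q c (nc n) * qpoch q d (nd n)
        * qpoch q (q * a\<^sup>2 / (b * c * d)) (ne n))
       / (qpoch q q n * qpoch q (b * c * d / a) (nb n + nc n + nd n))
     * ((qpoch q (b * c / a) (nb n + nc n) * qpoch q (q * a / (b * c)) (nd n + ne n))
       / qpoch q (q * a / b) (nc n + nd n + ne n))
     * ((qpoch q (b * d / a) (nb n + nd n) * qpoch q (q * a / (b * d)) (nc n + ne n))
       / qpoch q (q * a / c) (nb n + nd n + ne n))
     * ((qpoch q (c * d / a) (nc n + nd n) * qpoch q (q * a / (c * d)) (nb n + ne n))
       / qpoch q (q * a / d) (nb n + nc n + ne n))"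

definition Theta :: "complex \<Rightarrow> complex \<Rightarrow> complex \<Rightarrow> complex \<Rightarrow> complex
    \<Rightarrow> (nat \<Rightarrow> nat) \<Rightarrow> (nat \<Rightarrow> nat) \<Rightarrow> (nat \<Rightarrow> nat) \<Rightarrow> (nat \<Rightarrow> nat)
    \<Rightarrow> nat \<Rightarrow> complex" where
  "Theta q a b c d nb nc nd ne m =
     q powi (int (m choose 2) - int (nb m choose 2) - int (nc m choose 2)
               - int (nd m choose 2) - int (ne m choose 2))
     * (a / b) ^ nb m * (a / c) ^ nc m * (a / d) ^ nd m * (b * c * d / (q * a)) ^ ne m"

end

theory Submission
  imports Defs
begin

text \<open>
  Put \<open>e = q a\<^sup>2/(b c d)\<close>; then everything is symmetric in \<open>b, c, d, e\<close>. For fixed \<open>n\<close> the series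
  has a terminating companion, whose \<open>k\<close>-th term is multiplied by a factor that vanishes for
  \<open>k > n\<close> and tends to \<open>1\<close> as \<open>n \<rightarrow> \<infinity>\<close>, and whose sum is
  \<open>(b, c, d, e; q)\<^sub>n / (qa/b, qa/c, qa/d, qa/e; q)\<^sub>n\<close>. This is proved by induction on \<open>n\<close> with a
  WZ certificate which is a function of the lattice point \<open>(\<langle>k\<rangle>\<^sub>b, \<langle>k\<rangle>\<^sub>c, \<langle>k\<rangle>\<^sub>d, \<langle>k\<rangle>\<^sub>e)\<close> only, so
  that the telescoping works along every lattice path. The limit \<open>n \<rightarrow> \<infinity>\<close> is Tannery's theorem.
  It needs absolute convergence: if at least two of the \<open>\<lambda>\<^sub>x\<close> are positive, \<open>\<Theta>\<close> decays
  superexponentially; otherwise \<open>\<Theta>(k) = (a/x)\<^sup>k\<close>, and since \<open>H\<close> stays away from \<open>0\<close>, already the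
  convergence of the terms to \<open>0\<close> forces \<open>|a/x| < 1\<close>.
\<close>

section \<open>The rational identity behind the WZ certificate\<close>

text \<open>With \<open>B = b q^i\<close>, \<open>C = c q^j\<close>, \<open>D = d q^k\<close>,
  \<open>E = e q^l\<close>, \<open>K = q^(i+j+k+l)\<close> and \<open>Q = q^n\<close> this is the WZ
  equation for a step in direction \<open>b\<close>, cleared of common factors. Both sides are
  symmetric in \<open>C\<close>, \<open>D\<close>, \<open>E\<close>, and \<open>bal\<close> fixes
  the product \<open>C*D*E\<close>, so only the first two elementary symmetric polynomials remain
  free. The second claim is the first at \<open>K = 1\<close> with
  \<open>(1 - B)*(1 - q*Q)*(1 - a*Q)\<close> cancelled, a factor that may vanish.\<close>

lemma key_identity:
  fixes a B C D E q Q K :: complex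
  assumes nz: "a \<noteq> 0" "B \<noteq> 0" "C \<noteq> 0" "D \<noteq> 0" "E \<noteq> 0" "q \<noteq> 0" "K \<noteq> 0"
    and bal: "B * C * D * E = q * a\<^sup>2 * K"
  shows "(1 - K*B) * ((1 - q*Q) * (1 - a*Q*K) * (1 - a*Q/B)
             * ((1 - a*q*Q/C) * (1 - a*q*Q/D) * (1 - a*q*Q/E))
           - (1 - q*Q/K) * (1 - a*Q) * (1 - B*q*Q) * ((1 - C*Q) * (1 - D*Q) * (1 - E*Q)))
     = (1 - a*q*Q\<^sup>2) * ((q*Q/K) * (1 - K) * ((1 - a*K/C) * (1 - a*K/D) * (1 - a*K/E)) * (1 - a*Q/B) * (1 - B*q*Q)
          - (Q/K) * (a*K/B) * (1 - B) * ((1 - B*C/a) * (1 - B*D/a) * (1 - B*E/a)) * (1 - q*Q/K) * (1 - a*Q*K))"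
    (is ?full)
    and "K = 1 \<Longrightarrow> (1 - a*Q/B) * ((1 - a*q*Q/C) * (1 - a*q*Q/D) * (1 - a*q*Q/E))
           - (1 - B*q*Q) * ((1 - C*Q) * (1 - D*Q) * (1 - E*Q))
     = - (1 - a*q*Q\<^sup>2) * Q * (a/B) * ((1 - B*C/a) * (1 - B*D/a) * (1 - B*E/a))"
    (is "_ \<Longrightarrow> ?base")
proof -
  define e1 where "e1 = C + D + E"
  define e2 where "e2 = C*D + C*E + D*E"
  have e3: "C*D*E = q*a\<^sup>2*K/B" using bal nz by (simp add: field_simps)
  have pos: "(1 - t*C)*(1-t*D)*(1-t*E) = 1 - t*e1 + t^2*e2 - t^3*(q*a\<^sup>2*K/B)" for t
    unfolding e1_def e2_def e3[symmetric] by algebra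
  have neg: "(1 - t/C)*(1-t/D)*(1-t/E) = 1 - t*B*e2/(q*a\<^sup>2*K) + t^2*B*e1/(q*a\<^sup>2*K) - t^3*B/(q*a\<^sup>2*K)" for t
  proof -
    have "(1 - t/C)*(1-t/D)*(1-t/E) = 1 - t*(e2/(C*D*E)) + t^2*(e1/(C*D*E)) - t^3/(C*D*E)"
      unfolding e1_def e2_def using nz by (simp add: field_simps power2_eq_square power3_eq_cube)
    then show ?thesis unfolding e3 by (simp add: mult_ac)
  qed
  have P2: "(1 - C*Q) * (1 - D*Q) * (1 - E*Q) = 1 - Q*e1 + Q^2*e2 - Q^3*(q*a\<^sup>2*K/B)"
    using pos[of Q] by (simp add: mult_ac)
  have P3: "(1 - B*C/a) * (1 - B*D/a) * (1 - B*E/a) = 1 - (B/a)*e1 + (B/a)^2*e2 - (B/a)^3*(q*a\<^sup>2*K/B)"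
    using pos[of "B/a"] by simp
  show ?full unfolding neg P2 P3
    using nz by (simp add: field_simps power2_eq_square power3_eq_cube)
  show ?base if "K = 1" unfolding neg P2 P3
    using nz that by (simp add: field_simps power2_eq_square power3_eq_cube)
qed

section \<open>Terms, coefficients and certificate of the WZ pair\<close>

text \<open>
  Encoding: \<open>i, j, k, l\<close> stand for \<open>\<langle>m\<rangle>\<^sub>b, \<langle>m\<rangle>\<^sub>c, \<langle>m\<rangle>\<^sub>d, \<langle>m\<rangle>\<^sub>e\<close>, primed for \<open>m + 1\<close>. Up to a nonzero factor,
  \<open>den\<close> is \<open>\<phi>(q\<^sup>n)\<close>; \<open>weight\<close> is \<open>\<Theta>\<close> and \<open>hyper\<close> is \<open>H\<close>. The product \<open>mix\<close>
  is the common part of the denominators at \<open>n\<close> and \<open>n + 1\<close>.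
\<close>

definition den1 :: "complex \<Rightarrow> complex \<Rightarrow> complex \<Rightarrow> nat \<Rightarrow> nat \<Rightarrow> complex" where
  "den1 q a x n m = (\<Prod>i<m. (1 - x*q^n*q^i) * (1 - a/x*(q^n/q^i)))"

definition mix1 :: "complex \<Rightarrow> complex \<Rightarrow> complex \<Rightarrow> nat \<Rightarrow> nat \<Rightarrow> complex" where
  "mix1 q a x n m = (\<Prod>i<m. (1 - x*q^Suc n*q^i) * (1 - a/x*(q^n/q^i)))"

definition den :: "complex \<Rightarrow> complex \<Rightarrow> complex \<Rightarrow> complex \<Rightarrow> complex \<Rightarrow> complex \<Rightarrow> nat
    \<Rightarrow> nat \<Rightarrow> nat \<Rightarrow> nat \<Rightarrow> nat \<Rightarrow> complex" where
  "den q a b c d e n i j k l = den1 q a b n i * den1 q a c n j * den1 q a d n k * den1 q a e n l"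

definition mix :: "complex \<Rightarrow> complex \<Rightarrow> complex \<Rightarrow> complex \<Rightarrow> complex \<Rightarrow> complex \<Rightarrow> nat
    \<Rightarrow> nat \<Rightarrow> nat \<Rightarrow> nat \<Rightarrow> nat \<Rightarrow> complex" where
  "mix q a b c d e n i j k l = mix1 q a b n i * mix1 q a c n j * mix1 q a d n k * mix1 q a e n l"

definition weight :: "complex \<Rightarrow> complex \<Rightarrow> complex \<Rightarrow> complex \<Rightarrow> complex \<Rightarrow> complex
    \<Rightarrow> nat \<Rightarrow> nat \<Rightarrow> nat \<Rightarrow> nat \<Rightarrow> complex" where
  "weight q a b c d e i j k l =
     q^(i*j + i*k + i*l + j*k + j*l + k*l) * ((a/b)^i * (a/c)^j * (a/d)^k * (a/e)^l)"

definition hyper :: "complex \<Rightarrow> complex \<Rightarrow> complex \<Rightarrow> complex \<Rightarrow> complex \<Rightarrow> complex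
    \<Rightarrow> nat \<Rightarrow> nat \<Rightarrow> nat \<Rightarrow> nat \<Rightarrow> complex" where
  "hyper q a b c d e i j k l =
     (qpoch q b i * qpoch q c j * qpoch q d k * qpoch q e l)
     * (qpoch q (b*c/a) (i+j) * qpoch q (b*d/a) (i+k) * qpoch q (b*e/a) (i+l)
        * qpoch q (c*d/a) (j+k) * qpoch q (c*e/a) (j+l) * qpoch q (d*e/a) (k+l))
     / (qpoch q q (i+j+k+l) * (qpoch q (q*a/b) (j+k+l) * qpoch q (q*a/c) (i+k+l)
        * qpoch q (q*a/d) (i+j+l) * qpoch q (q*a/e) (i+j+k)))"

definition coef :: "complex \<Rightarrow> complex \<Rightarrow> complex \<Rightarrow> complex \<Rightarrow> complex \<Rightarrow> complex
    \<Rightarrow> nat \<Rightarrow> nat \<Rightarrow> nat \<Rightarrow> nat \<Rightarrow> complex" where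
  "coef q a b c d e i j k l = weight q a b c d e i j k l * hyper q a b c d e i j k l"

text \<open>For nonzero \<open>q\<close> this is \<open>(q^(-n); q)_m * (a q^n; q)_m\<close> up to
  sign and a power of \<open>q\<close>; the factor \<open>j = n\<close> makes it vanish for
  \<open>m > n\<close>.\<close>

definition num :: "complex \<Rightarrow> complex \<Rightarrow> nat \<Rightarrow> nat \<Rightarrow> complex" where
  "num q a n m = (\<Prod>j<m. (1 - q^n/q^j) * (1 - a*q^n*q^j))"

text \<open>The common part of \<open>num\<close> at \<open>n\<close> and at \<open>n + 1\<close>,
  for positive \<open>m\<close>.\<close>

definition num' :: "complex \<Rightarrow> complex \<Rightarrow> nat \<Rightarrow> nat \<Rightarrow> complex" where
  "num' q a n m = (\<Prod>j\<in>{1..<m}. (1 - q^Suc n/q^j) * (1 - a*q^n*q^j))"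

text \<open>The function G in F(n+1,k) - r(n) F(n,k) = G(n,k+1) - G(n,k), where F is
  \<open>wz_term\<close> and r is \<open>wz_ratio\<close>. The factor \<open>1 - q^(i+j+k+l)\<close>
  makes it vanish at the origin.\<close>

definition wz_cert :: "complex \<Rightarrow> complex \<Rightarrow> complex \<Rightarrow> complex \<Rightarrow> complex \<Rightarrow> complex \<Rightarrow> nat
    \<Rightarrow> nat \<Rightarrow> nat \<Rightarrow> nat \<Rightarrow> nat \<Rightarrow> complex" where
  "wz_cert q a b c d e n i j k l =
     - coef q a b c d e i j k l * num' q a n (i+j+k+l) * (1 - q^(i+j+k+l))
     * ((1 - q^(j+k+l)*a/b) * (1 - q^(i+k+l)*a/c) * (1 - q^(i+j+l)*a/d) * (1 - q^(i+j+k)*a/e))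
     * (1 - a*q*(q^n)\<^sup>2) * (q^Suc n/q^(i+j+k+l))
     / (mix q a b c d e n i j k l
        * ((1 - a/b*q^Suc n) * (1 - a/c*q^Suc n) * (1 - a/d*q^Suc n) * (1 - a/e*q^Suc n)))"

text \<open>Summand of the terminating companion at index \<open>i+j+k+l\<close>. The primed point
  is the next one on the path, since \<open>den\<close> is evaluated one step ahead of
  \<open>coef\<close>.\<close>

definition wz_term :: "complex \<Rightarrow> complex \<Rightarrow> complex \<Rightarrow> complex \<Rightarrow> complex \<Rightarrow> complex \<Rightarrow> nat
    \<Rightarrow> nat \<Rightarrow> nat \<Rightarrow> nat \<Rightarrow> nat \<Rightarrow> nat \<Rightarrow> nat \<Rightarrow> nat \<Rightarrow> nat \<Rightarrow> complex" where
  "wz_term q a b c d e n i j k l i' j' k' l' =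
     coef q a b c d e i j k l * (den q a b c d e (i+j+k+l) i' j' k' l' / den q a b c d e (i+j+k+l) i j k l)
     * num q a n (i+j+k+l) / den q a b c d e n i' j' k' l'"

text \<open>Quotient of the closed form of the terminating sum at \<open>n + 1\<close> by that at
  \<open>n\<close>.\<close>

definition wz_ratio :: "complex \<Rightarrow> complex \<Rightarrow> complex \<Rightarrow> complex \<Rightarrow> complex \<Rightarrow> complex \<Rightarrow> nat \<Rightarrow> complex" where
  "wz_ratio q a b c d e n = ((1 - b*q^n) * (1 - c*q^n) * (1 - d*q^n) * (1 - e*q^n)) /
        ((1 - a/b*q^Suc n) * (1 - a/c*q^Suc n) * (1 - a/d*q^Suc n) * (1 - a/e*q^Suc n))"

section \<open>Shifting the products in the level and in the lattice point\<close>

lemma den1_Suc: "den1 q a x n (Suc m) = den1 q a x n m * ((1 - x*q^n*q^m) * (1 - a/x*(q^n/q^m)))"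
  by (simp add: den1_def)

lemma mix1_Suc: "mix1 q a x n (Suc m) = mix1 q a x n m * ((1 - x*q^Suc n*q^m) * (1 - a/x*(q^n/q^m)))"
  by (simp add: mix1_def)

text \<open>Passing from \<open>(x q^n; q)_m\<close> to \<open>(x q^(n+1); q)_m\<close> only trades
  the first factor for a new last one. This and the analogue \<open>den1_Suc_mix1\<close> avoid
  division, since the end factors may vanish.\<close>

lemma den1_mix1:
  "den1 q a x n m * (1 - x*q^n*q^m) = (1 - x*q^n) * mix1 q a x n m"
proof (induction m)
  case 0 then show ?case by (simp add: den1_def mix1_def)
next
  case (Suc m)
  have "den1 q a x n (Suc m) * (1 - x*q^n*q^Suc m)
     = (den1 q a x n m * (1 - x*q^n*q^m)) * ((1 - a/x*(q^n/q^m)) * (1 - x*q^Suc n*q^m))"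
    unfolding den1_Suc by (simp add: mult_ac)
  also have "\<dots> = (1 - x*q^n) * mix1 q a x n (Suc m)"
    unfolding Suc mix1_Suc by (simp add: mult_ac)
  finally show ?case .
qed

lemma den1_Suc_mix1:
  assumes "q \<noteq> 0"
  shows "den1 q a x (Suc n) m * (1 - a/x*(q^Suc n/q^m)) = (1 - a/x*q^Suc n) * mix1 q a x n m"
proof (induction m)
  case 0 then show ?case by (simp add: den1_def mix1_def)
next
  case (Suc m)
  have "den1 q a x (Suc n) (Suc m) * (1 - a/x*(q^Suc n/q^Suc m))
     = (den1 q a x (Suc n) m * (1 - a/x*(q^Suc n/q^m))) * ((1 - a/x*(q^n/q^m)) * (1 - x*q^Suc n*q^m))"
    unfolding den1_Suc using assms by (simp add: mult_ac)
  also have "\<dots> = (1 - a/x*q^Suc n) * mix1 q a x n (Suc m)"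
    unfolding Suc mix1_Suc by (simp add: mult_ac)
  finally show ?case .
qed

text \<open>Each factor of \<open>mix1\<close> at \<open>n\<close> occurs in \<open>den1\<close> at
  \<open>n + 1\<close> or at \<open>n\<close>.\<close>

lemma mix1_nonzero: "den1 q a x n m \<noteq> 0 \<Longrightarrow> den1 q a x (Suc n) m \<noteq> 0 \<Longrightarrow> mix1 q a x n m \<noteq> 0"
  by (auto simp: den1_def mix1_def prod_zero_iff)

lemma num_0 [simp]: "num q a n 0 = 1"
  and num'_0 [simp]: "num' q a n 0 = 1" and num'_1 [simp]: "num' q a n (Suc 0) = 1"
  by (simp_all add: num_def num'_def)

lemma num'_Suc: "0 < m \<Longrightarrow> num' q a n (Suc m) = num' q a n m * ((1 - q*q^n/q^m) * (1 - a*q^n*q^m))"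
  by (simp add: num'_def prod.atLeastLessThan_Suc)

text \<open>Only end factors separate the three products. At \<open>m = 0\<close> all of them are
  empty and the formulas fail in general, so the induction starts at \<open>m = 1\<close>.\<close>

lemma num_num':
  assumes "0 < m" "q \<noteq> 0"
  shows "num q a n m = (1 - q*q^n/q^m) * (1 - a*q^n) * num' q a n m"
    and "num q a (Suc n) m = (1 - q*q^n) * (1 - a*q^n*q^m) * num' q a n m"
proof -
  have "num q a n (Suc m) = (1 - q*q^n/q^Suc m) * (1 - a*q^n) * num' q a n (Suc m) \<and>
        num q a (Suc n) (Suc m) = (1 - q*q^n) * (1 - a*q^n*q^Suc m) * num' q a n (Suc m)" for m
  proof (induction m)
    case 0 then show ?case using assms by (simp add: num_def mult_ac)
  next
    case (Suc m)
    have s: "num q a n (Suc (Suc m)) = num q a n (Suc m) * ((1 - q^n/q^Suc m) * (1 - a*q^n*q^Suc m))"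
      for n by (simp add: num_def)
    show ?case unfolding s using assms Suc by (simp add: num'_Suc mult_ac)
  qed
  from this[of "m - 1"] assms
  show "num q a n m = (1 - q*q^n/q^m) * (1 - a*q^n) * num' q a n m"
    and "num q a (Suc n) m = (1 - q*q^n) * (1 - a*q^n*q^m) * num' q a n m" by simp_all
qed

lemma qpoch_Suc: "qpoch q x (Suc n) = qpoch q x n * (1 - q^n*x)"
  by (simp add: qpoch_def)

lemma coef_Suc:
  "coef q a b c d e (Suc i) j k l = coef q a b c d e i j k l *
     (q^(j+k+l) * (a/b) * (1 - q^i*b)
      * ((1 - q^(i+j)*(b*c/a)) * (1 - q^(i+k)*(b*d/a)) * (1 - q^(i+l)*(b*e/a)))
     / ((1 - q^(i+j+k+l)*q) * ((1 - q^(i+k+l)*(q*a/c)) * (1 - q^(i+j+l)*(q*a/d)) * (1 - q^(i+j+k)*(q*a/e)))))"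
proof -
  have *: "q^(Suc i*j + Suc i*k + Suc i*l + j*k + j*l + k*l) = q^(i*j + i*k + i*l + j*k + j*l + k*l) * q^(j+k+l)"
    by (simp flip: power_add add: algebra_simps)
  have coef: "coef q a b c d e i j k l =
     q^(i*j + i*k + i*l + j*k + j*l + k*l) * ((a/b)^i * (a/c)^j * (a/d)^k * (a/e)^l)
     * (qpoch q b i * qpoch q c j * qpoch q d k * qpoch q e l)
     * (qpoch q (b*c/a) (i+j) * qpoch q (b*d/a) (i+k) * qpoch q (b*e/a) (i+l)
        * qpoch q (c*d/a) (j+k) * qpoch q (c*e/a) (j+l) * qpoch q (d*e/a) (k+l))
     / (qpoch q q (i+j+k+l) * (qpoch q (q*a/b) (j+k+l) * qpoch q (q*a/c) (i+k+l)
        * qpoch q (q*a/d) (i+j+l) * qpoch q (q*a/e) (i+j+k)))" for i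
    unfolding coef_def weight_def hyper_def by (simp only: times_divide_eq_right mult.assoc)
  show ?thesis unfolding coef *
    by (simp only: qpoch_Suc add_Suc power_Suc times_divide_times_eq) (simp only: mult_ac)
qed

lemma inverse_den1_Suc:
  assumes "q \<noteq> 0" "den1 q a x (Suc n) m \<noteq> 0" "mix1 q a x n m \<noteq> 0" "1 - a/x*q^Suc n \<noteq> 0"
  shows "1 / den1 q a x (Suc n) m = (1 - a*q*q^n/(x*q^m)) / (mix1 q a x n m * (1 - a/x*q^Suc n))"
proof -
  have "1 - a*q*q^n/(x*q^m) = 1 - a/x*(q^Suc n/q^m)" by simp
  then show ?thesis
    using den1_Suc_mix1[of q a x n m] assms by (simp add: frac_eq_eq mult_ac)
qed

lemma ratio_den1:
  assumes "den1 q a x n m \<noteq> 0" "mix1 q a x n m \<noteq> 0"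
  shows "(1 - x*q^n) / den1 q a x n m = (1 - x*q^m*q^n) / mix1 q a x n m"
  using den1_mix1[of q a x n m] assms by (simp add: frac_eq_eq mult_ac)

section \<open>The WZ equation along one lattice step\<close>

text \<open>Serves the step that leaves the origin, where \<open>num\<close> is \<open>1\<close> and
  the certificate vanishes; there the cancelled form of the key identity applies.\<close>

lemma key_scaled_initial:
  fixes m :: complex
  assumes "w*P1 - z*P2 = - R*Q*u*P3"
  shows "m*((1-B)*(1-u))*P1*w - m*((1-B)*(1-u))*P2*z = - m*(1-u)*R*Q*u*(1-B)*P3"
proof -
  have "m*((1-B)*(1-u))*P1*w - m*((1-B)*(1-u))*P2*z = m*(1-B)*(1-u)*(w*P1 - z*P2)"
    by (simp add: algebra_simps)
  also have "\<dots> = - m*(1-u)*R*Q*u*(1-B)*P3" unfolding assms by (simp add: algebra_simps)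
  finally show ?thesis .
qed

text \<open>The key identity times the common prefactor, in the exact shape of the goal in
  \<open>wz_step\<close>. Here \<open>N\<close> stands for \<open>num'\<close>,
  \<open>g1*g2*N\<close> for \<open>num\<close> at \<open>n + 1\<close>, and \<open>h1*h2*N\<close>
  for \<open>num\<close> at \<open>n\<close>.\<close>

lemma key_scaled:
  fixes m :: complex
  assumes "(1-K*B)*(g1*g2*w*P1 - h1*h2*z*P2) = R*(t*(1-K)*(x1*x2*x3)*w*z - Q*u*(1-B)*P3*h1*g2)"
  shows "m*((1-K*B)*(1-u))*(g1*g2*N)*P1*w - m*((1-K*B)*(1-u))*(h1*h2*N)*P2*z
    = - m*(N*(h1*g2))*(1-u)*R*Q*u*(1-B)*P3 - - m*N*(1-K)*((1-u)*x1*x2*x3)*R*t*(z*w)"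
proof -
  have "m*((1-K*B)*(1-u))*(g1*g2*N)*P1*w - m*((1-K*B)*(1-u))*(h1*h2*N)*P2*z
      = m*(1-u)*N*((1-K*B)*(g1*g2*w*P1 - h1*h2*z*P2))"
    by (simp add: algebra_simps)
  also have "\<dots> = - m*(N*(h1*g2))*(1-u)*R*Q*u*(1-B)*P3 - - m*N*(1-K)*((1-u)*x1*x2*x3)*R*t*(z*w)"
    unfolding assms by (simp add: algebra_simps)
  finally show ?thesis .
qed

text \<open>
  The second claim is needed for the last summand, where \<open>den\<close> at \<open>n\<close> may vanish
  beyond the range covered by the hypothesis on \<open>\<phi>\<close>.
\<close>

lemma wz_step:
  assumes nz: "q \<noteq> 0" "a \<noteq> 0" "b \<noteq> 0" "c \<noteq> 0" "d \<noteq> 0" "e \<noteq> 0"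
    and bal: "b*c*d*e = q*a\<^sup>2"
    and q: "\<And>m. q^Suc m \<noteq> 1"
    and P: "\<And>m. q^Suc m*a \<noteq> b" "\<And>m. q^Suc m*a \<noteq> c" "\<And>m. q^Suc m*a \<noteq> d" "\<And>m. q^Suc m*a \<noteq> e"
    and D: "den q a b c d e (i+j+k+l) i j k l \<noteq> 0" "den q a b c d e n i j k l \<noteq> 0"
       "den q a b c d e (Suc n) (Suc i) j k l \<noteq> 0"
  shows "den q a b c d e n (Suc i) j k l \<noteq> 0 \<Longrightarrow>
      wz_term q a b c d e (Suc n) i j k l (Suc i) j k l - wz_ratio q a b c d e n * wz_term q a b c d e n i j k l (Suc i) j k l
      = wz_cert q a b c d e n (Suc i) j k l - wz_cert q a b c d e n i j k l"
   and "i+j+k+l = Suc n \<Longrightarrow>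
      wz_term q a b c d e (Suc n) i j k l (Suc i) j k l = - wz_cert q a b c d e n i j k l"
proof -
  define B where "B = b*q^i"
  define C where "C = c*q^j"
  define D' where "D' = d*q^k"
  define E where "E = e*q^l"
  define K where "K = q^(i+j+k+l)"
  define Q where "Q = q^n"
  have NZ: "B \<noteq> 0" "C \<noteq> 0" "D' \<noteq> 0" "E \<noteq> 0" "K \<noteq> 0"
    using nz by (auto simp: B_def C_def D'_def E_def K_def)
  have bal': "B*C*D'*E = q*a\<^sup>2*K"
    using bal by (simp add: B_def C_def D'_def E_def K_def power_add flip: bal)
  have r: "1 - a/b*q^Suc n \<noteq> 0" "1 - a/c*q^Suc n \<noteq> 0" "1 - a/d*q^Suc n \<noteq> 0" "1 - a/e*q^Suc n \<noteq> 0"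
    using P[of n] nz by (auto simp: field_simps)
  define R where "R = (1 - a/b*q^Suc n) * (1 - a/c*q^Suc n) * (1 - a/d*q^Suc n) * (1 - a/e*q^Suc n)"
  have dn: "den1 q a b n i \<noteq> 0" "den1 q a c n j \<noteq> 0" "den1 q a d n k \<noteq> 0" "den1 q a e n l \<noteq> 0"
    using D by (auto simp: den_def)
  have dS: "den1 q a b (Suc n) i \<noteq> 0" "den1 q a c (Suc n) j \<noteq> 0" "den1 q a d (Suc n) k \<noteq> 0" "den1 q a e (Suc n) l \<noteq> 0"
    and BqQ: "1 - B*q*Q \<noteq> 0" and aqQB: "1 - a*q*Q/B \<noteq> 0"
    using D nz by (auto simp: den_def den1_Suc B_def Q_def mult_ac)
  have mx: "mix1 q a b n i \<noteq> 0" "mix1 q a c n j \<noteq> 0" "mix1 q a d n k \<noteq> 0" "mix1 q a e n l \<noteq> 0"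
    using mix1_nonzero dn dS by blast+
  \<comment> \<open>The prefactor shared by both terms and both certificate values.\<close>
  define m where "m = coef q a b c d e i j k l / (mix q a b c d e n i j k l * R)"
  have v: "den q a b c d e (i+j+k+l) (Suc i) j k l / den q a b c d e (i+j+k+l) i j k l
    = (1 - K*B) * (1 - a*K/B)"
    using D(1) nz by (simp add: den_def den1_Suc B_def K_def mult_ac)
  have T1: "wz_term q a b c d e (Suc n) i j k l (Suc i) j k l
     = m * ((1 - K*B) * (1 - a*K/B)) * num q a (Suc n) (i+j+k+l)
       * ((1 - a*q*Q/C) * (1 - a*q*Q/D') * (1 - a*q*Q/E)) / (1 - B*q*Q)"
  proof -
    have "1 / den q a b c d e (Suc n) (Suc i) j k l
      = (1 / den1 q a b (Suc n) i) * (1 / den1 q a c (Suc n) j) * (1 / den1 q a d (Suc n) k)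
        * (1 / den1 q a e (Suc n) l) / ((1 - B*q*Q) * (1 - a*q*Q/B))"
      using nz by (simp add: den_def den1_Suc B_def Q_def mult_ac)
    also have "\<dots> = ((1 - a*q*Q/C) * (1 - a*q*Q/D') * (1 - a*q*Q/E)) / (1 - B*q*Q)
         / (mix q a b c d e n i j k l * R)"
      unfolding inverse_den1_Suc[OF nz(1) dS(1) mx(1) r(1)] inverse_den1_Suc[OF nz(1) dS(2) mx(2) r(2)]
        inverse_den1_Suc[OF nz(1) dS(3) mx(3) r(3)] inverse_den1_Suc[OF nz(1) dS(4) mx(4) r(4)]
        mix_def R_def B_def[symmetric] C_def[symmetric] D'_def[symmetric] E_def[symmetric] Q_def[symmetric]
      using aqQB NZ by (simp add: mult_ac del: power_Suc)
    finally have "1 / den q a b c d e (Suc n) (Suc i) j k l = \<dots>" .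
    then show ?thesis
      unfolding wz_term_def v m_def by (simp add: divide_inverse mult_ac)
  qed
  have T0: "wz_ratio q a b c d e n * wz_term q a b c d e n i j k l (Suc i) j k l
     = m * ((1 - K*B) * (1 - a*K/B)) * num q a n (i+j+k+l)
       * ((1 - C*Q) * (1 - D'*Q) * (1 - E*Q)) / (1 - a*Q/B)"
    if nzd: "den q a b c d e n (Suc i) j k l \<noteq> 0"
  proof -
    have BQ: "1 - B*Q \<noteq> 0" and aQB: "1 - a*Q/B \<noteq> 0"
      using nzd nz by (auto simp: den_def den1_Suc B_def Q_def mult_ac)
    have "wz_ratio q a b c d e n / den q a b c d e n (Suc i) j k l
      = ((1 - b*q^n) / den1 q a b n i) * ((1 - c*q^n) / den1 q a c n j) * ((1 - d*q^n) / den1 q a d n k)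
        * ((1 - e*q^n) / den1 q a e n l) / ((1 - B*Q) * (1 - a*Q/B)) / R"
      using nz by (simp add: den_def den1_Suc B_def Q_def R_def wz_ratio_def mult_ac)
    also have "\<dots> = ((1 - C*Q) * (1 - D'*Q) * (1 - E*Q)) / (1 - a*Q/B)
         / (mix q a b c d e n i j k l * R)"
      unfolding ratio_den1[OF dn(1) mx(1)] ratio_den1[OF dn(2) mx(2)] ratio_den1[OF dn(3) mx(3)] ratio_den1[OF dn(4) mx(4)]
      using BQ by (simp add: mix_def C_def D'_def E_def B_def Q_def mult_ac)
    finally have "wz_ratio q a b c d e n / den q a b c d e n (Suc i) j k l = \<dots>" .
    then show ?thesis
      unfolding wz_term_def v m_def by (simp add: divide_inverse mult_ac)
  qed
  have e: "q^(j+k+l)*a/b = a*K/B" "q^(i+k+l)*a/c = a*K/C" "q^(i+j+l)*a/d = a*K/D'" "q^(i+j+k)*a/e = a*K/E"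
    using nz by (simp_all add: K_def B_def C_def D'_def E_def power_add)
  have W0: "wz_cert q a b c d e n i j k l = - m * num' q a n (i+j+k+l) * (1 - K)
       * ((1 - a*K/B) * (1 - a*K/C) * (1 - a*K/D') * (1 - a*K/E)) * (1 - a*q*Q\<^sup>2) * (q*Q/K)"
    unfolding wz_cert_def e m_def R_def Q_def K_def by simp
  have W1: "wz_cert q a b c d e n (Suc i) j k l = - m * num' q a n (Suc (i+j+k+l))
       * (1 - a*K/B) * (1 - a*q*Q\<^sup>2) * (Q/K) * (a*K/B) * (1 - B) * ((1 - B*C/a) * (1 - B*D'/a) * (1 - B*E/a))
       / ((1 - B*q*Q) * (1 - a*Q/B))"
  proof -
    have y: "q^(i+j)*(b*c/a) = B*C/a" "q^(i+k)*(b*d/a) = B*D'/a" "q^(i+l)*(b*e/a) = B*E/a"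
      "q^(j+k+l)*(a/b) = a*K/B" "q^(i+k+l)*(q*a/c) = q*(a*K/C)" "q^(i+j+l)*(q*a/d) = q*(a*K/D')"
      "q^(i+j+k)*(q*a/e) = q*(a*K/E)" "q^(i+j+k+l) = K" "q^i*b = B"
      using nz by (simp_all add: K_def B_def C_def D'_def E_def power_add)
    have g: "1 - K*q \<noteq> 0" "1 - q*(a*K/C) \<noteq> 0" "1 - q*(a*K/D') \<noteq> 0" "1 - q*(a*K/E) \<noteq> 0"
    proof -
      show "1 - K*q \<noteq> 0" using q[of "i+j+k+l"] by (simp add: K_def mult_ac)
      show "1 - q*(a*K/C) \<noteq> 0" using P(2)[of "i+k+l"] nz
        unfolding y(5)[symmetric] by (simp add: field_simps)
      show "1 - q*(a*K/D') \<noteq> 0" using P(3)[of "i+j+l"] nz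
        unfolding y(6)[symmetric] by (simp add: field_simps)
      show "1 - q*(a*K/E) \<noteq> 0" using P(4)[of "i+j+k"] nz
        unfolding y(7)[symmetric] by (simp add: field_simps)
    qed
    \<comment> \<open>The denominator introduced by \<open>coef_Suc\<close>. The certificate at the
      new point has the same factors in its numerator, so they cancel and only
      \<open>1 - a*K/B\<close> survives.\<close>
    define G where "G = (1 - K*q) * ((1 - q*(a*K/C)) * (1 - q*(a*K/D')) * (1 - q*(a*K/E)))"
    have G: "G \<noteq> 0" using g by (simp add: G_def)
    have mm: "mix q a b c d e n (Suc i) j k l = mix q a b c d e n i j k l * ((1 - B*q*Q) * (1 - a*Q/B))"
      using nz by (simp add: mix_def mix1_Suc B_def Q_def mult_ac)
    have f: "(1 - q^(Suc i+j+k+l)) * ((1 - q^(j+k+l)*a/b) * (1 - q^(Suc i+k+l)*a/c) * (1 - q^(Suc i+j+l)*a/d) * (1 - q^(Suc i+j+k)*a/e))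
        = G * (1 - a*K/B)"
    proof -
      have "q^(Suc i+k+l)*a/c = q*(q^(i+k+l)*a/c)" "q^(Suc i+j+l)*a/d = q*(q^(i+j+l)*a/d)"
        "q^(Suc i+j+k)*a/e = q*(q^(i+j+k)*a/e)" "q^(Suc i+j+k+l) = q*K"
        by (simp_all add: K_def)
      then show ?thesis unfolding e by (simp only: e G_def mult_ac)
    qed
    have u: "q^Suc n/q^(Suc i+j+k+l) = Q/K" using nz by (simp add: Q_def K_def)
    have "wz_cert q a b c d e n (Suc i) j k l =
      - coef q a b c d e (Suc i) j k l * num' q a n (Suc (i+j+k+l)) * (G * (1 - a*K/B))
       * (1 - a*q*Q\<^sup>2) * (Q/K) / (mix q a b c d e n i j k l * ((1 - B*q*Q) * (1 - a*Q/B)) * R)"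
      unfolding wz_cert_def f[symmetric] mm u R_def Q_def by (simp add: mult_ac)
    also have "coef q a b c d e (Suc i) j k l = coef q a b c d e i j k l *
      ((a*K/B) * (1 - B) * ((1 - B*C/a) * (1 - B*D'/a) * (1 - B*E/a)) / G)"
      unfolding coef_Suc y G_def ..
    finally show ?thesis
      using G unfolding m_def by (simp add: divide_inverse mult_ac)
  qed
  show "wz_term q a b c d e (Suc n) i j k l (Suc i) j k l - wz_ratio q a b c d e n * wz_term q a b c d e n i j k l (Suc i) j k l
      = wz_cert q a b c d e n (Suc i) j k l - wz_cert q a b c d e n i j k l"
    if nzd: "den q a b c d e n (Suc i) j k l \<noteq> 0"
  proof -
    have aQB: "1 - a*Q/B \<noteq> 0"
      using nzd nz by (auto simp: den_def den1_Suc B_def Q_def mult_ac)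
    note key = key_identity[OF nz(2) NZ(1-4) nz(1) NZ(5) bal', of Q]
    \<comment> \<open>Clears the two remaining denominators: \<open>1 - B*q*Q\<close> comes from
      level \<open>n + 1\<close>, \<open>1 - a*Q/B\<close> from level \<open>n\<close>.\<close>
    have comb: "X1 / (1 - B*q*Q) - X2 / (1 - a*Q/B) = Y1 / ((1 - B*q*Q) * (1 - a*Q/B)) - Y2"
      if "X1 * (1 - a*Q/B) - X2 * (1 - B*q*Q) = Y1 - Y2 * ((1 - B*q*Q) * (1 - a*Q/B))" for X1 X2 Y1 Y2
    proof -
      have "X1 / (1 - B*q*Q) - X2 / (1 - a*Q/B) = (X1 * (1 - a*Q/B) - X2 * (1 - B*q*Q)) / ((1 - B*q*Q) * (1 - a*Q/B))"
        using BqQ aQB by (simp add: diff_divide_distrib)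
      then show ?thesis unfolding that using BqQ aQB by (simp add: diff_divide_distrib)
    qed
    show ?thesis
    proof (cases "i+j+k+l = 0")
      case True
      then have K: "K = 1" by (simp add: K_def)
      show ?thesis unfolding T1 T0[OF nzd] W0 W1
        unfolding True K num_0 num'_0 num'_1
        by (rule comb) (use key_scaled_initial[OF key(2)[OF K]] in simp)
    next
      case False
      then have pos: "0 < i+j+k+l" by simp
      note nn = num_num'[OF pos nz(1), of a n] num'_Suc[OF pos, of q a n]
      show ?thesis unfolding T1 T0[OF nzd] W0 W1
        unfolding nn K_def[symmetric] Q_def[symmetric]
        by (rule comb, rule key_scaled, rule key(1))
    qed
  qed
  show "wz_term q a b c d e (Suc n) i j k l (Suc i) j k l = - wz_cert q a b c d e n i j k l"
    if n: "i+j+k+l = Suc n"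
  proof -
    \<comment> \<open>Now \<open>1 - K*B\<close> cancels the denominator \<open>1 - B*q*Q\<close> in
      \<open>T1\<close>, and the rest agrees with \<open>W0\<close> up to sign, without any term at
      level \<open>n\<close>.\<close>
    have K: "K = q*Q" by (simp add: K_def Q_def n)
    show ?thesis unfolding T1 W0 n num_num'(2)[of "Suc n" q a n, OF _ nz(1), simplified]
      using BqQ NZ nz unfolding K Q_def[symmetric] by (simp add: power2_eq_square mult_ac)
  qed
qed

text \<open>\<open>wz_step\<close> moves in the first parameter only; these transpositions bring
  each of the other three into first place.\<close>

lemma coef_swap:
  "coef q a b c d e i j k l = coef q a c b d e j i k l"
  "coef q a b c d e i j k l = coef q a d c b e k j i l"
  "coef q a b c d e i j k l = coef q a e c d b l j k i"
  unfolding coef_def weight_def hyper_def by (simp_all only: mult_ac add_ac)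

lemma den_swap:
  "den q a b c d e n i j k l = den q a c b d e n j i k l"
  "den q a b c d e n i j k l = den q a d c b e n k j i l"
  "den q a b c d e n i j k l = den q a e c d b n l j k i"
  unfolding den_def by (simp_all only: mult_ac)

lemma mix_swap:
  "mix q a b c d e n i j k l = mix q a c b d e n j i k l"
  "mix q a b c d e n i j k l = mix q a d c b e n k j i l"
  "mix q a b c d e n i j k l = mix q a e c d b n l j k i"
  unfolding mix_def by (simp_all only: mult_ac)

lemma wz_term_swap:
  "wz_term q a b c d e n i j k l i' j' k' l' = wz_term q a c b d e n j i k l j' i' k' l'"
  "wz_term q a b c d e n i j k l i' j' k' l' = wz_term q a d c b e n k j i l k' j' i' l'"
  "wz_term q a b c d e n i j k l i' j' k' l' = wz_term q a e c d b n l j k i l' j' k' i'"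
    subgoal unfolding wz_term_def coef_swap(1)[of q a b c d e] den_swap(1)[of q a b c d e] by (simp only: add_ac)
    subgoal unfolding wz_term_def coef_swap(2)[of q a b c d e] den_swap(2)[of q a b c d e] by (simp only: add_ac)
    subgoal unfolding wz_term_def coef_swap(3)[of q a b c d e] den_swap(3)[of q a b c d e] by (simp only: add_ac)
  done

lemma wz_cert_swap:
  "wz_cert q a b c d e n i j k l = wz_cert q a c b d e n j i k l"
  "wz_cert q a b c d e n i j k l = wz_cert q a d c b e n k j i l"
  "wz_cert q a b c d e n i j k l = wz_cert q a e c d b n l j k i"
    subgoal unfolding wz_cert_def coef_swap(1)[of q a b c d e] mix_swap(1)[of q a b c d e] by (simp only: mult_ac add_ac)
    subgoal unfolding wz_cert_def coef_swap(2)[of q a b c d e] mix_swap(2)[of q a b c d e] by (simp only: mult_ac add_ac)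
    subgoal unfolding wz_cert_def coef_swap(3)[of q a b c d e] mix_swap(3)[of q a b c d e] by (simp only: mult_ac add_ac)
  done

lemma wz_ratio_swap:
  "wz_ratio q a b c d e n = wz_ratio q a c b d e n"
  "wz_ratio q a b c d e n = wz_ratio q a d c b e n"
  "wz_ratio q a b c d e n = wz_ratio q a e c d b n"
  unfolding wz_ratio_def by (simp_all only: mult_ac)

text \<open>By \<open>s\<close> exactly one coordinate grows, by one; exchanging its parameter with
  \<open>b\<close> reduces to \<open>wz_step\<close>.\<close>

lemma wz_step_any:
  assumes nz: "q \<noteq> 0" "a \<noteq> 0" "b \<noteq> 0" "c \<noteq> 0" "d \<noteq> 0" "e \<noteq> 0"
    and bal: "b*c*d*e = q*a\<^sup>2"
    and q: "\<And>m. q^Suc m \<noteq> 1"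
    and P: "\<And>m. q^Suc m*a \<noteq> b" "\<And>m. q^Suc m*a \<noteq> c" "\<And>m. q^Suc m*a \<noteq> d" "\<And>m. q^Suc m*a \<noteq> e"
    and s: "i'+j'+k'+l' = Suc (i+j+k+l)" "i \<le> i'" "j \<le> j'" "k \<le> k'" "l \<le> l'"
    and D: "den q a b c d e (i+j+k+l) i j k l \<noteq> 0" "den q a b c d e n i j k l \<noteq> 0"
       "den q a b c d e (Suc n) i' j' k' l' \<noteq> 0"
  shows "(den q a b c d e n i' j' k' l' \<noteq> 0 \<longrightarrow>
      wz_term q a b c d e (Suc n) i j k l i' j' k' l' - wz_ratio q a b c d e n * wz_term q a b c d e n i j k l i' j' k' l'
      = wz_cert q a b c d e n i' j' k' l' - wz_cert q a b c d e n i j k l)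
   \<and> (i+j+k+l = Suc n \<longrightarrow>
      wz_term q a b c d e (Suc n) i j k l i' j' k' l' = - wz_cert q a b c d e n i j k l)"
proof -
  consider "i' = Suc i" "j' = j" "k' = k" "l' = l" | "i' = i" "j' = Suc j" "k' = k" "l' = l"
    | "i' = i" "j' = j" "k' = Suc k" "l' = l" | "i' = i" "j' = j" "k' = k" "l' = Suc l"
    using s by linarith
  then show ?thesis
  proof cases
    case 1
    show ?thesis using wz_step[OF nz bal q P, of i j k l n] D unfolding 1 by blast
  next
    case 2
    have bal': "c*b*d*e = q*a\<^sup>2" and N: "i+j+k+l = j+i+k+l" using bal by (simp_all add: mult_ac)
    show ?thesis
      using wz_step[OF nz(1,2,4,3,5,6) bal' q P(2,1,3,4), of j i k l n] D
      unfolding 2 wz_term_swap(1)[of q a b c d e] wz_cert_swap(1)[of q a b c d e] wz_ratio_swap(1)[of q a b c d e]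
        den_swap(1)[of q a b c d e] N by blast
  next
    case 3
    have bal': "d*c*b*e = q*a\<^sup>2" and N: "i+j+k+l = k+j+i+l" using bal by (simp_all add: mult_ac)
    show ?thesis
      using wz_step[OF nz(1,2,5,4,3,6) bal' q P(3,2,1,4), of k j i l n] D
      unfolding 3 wz_term_swap(2)[of q a b c d e] wz_cert_swap(2)[of q a b c d e] wz_ratio_swap(2)[of q a b c d e]
        den_swap(2)[of q a b c d e] N by blast
  next
    case 4
    have bal': "e*c*d*b = q*a\<^sup>2" and N: "i+j+k+l = l+j+k+i" using bal by (simp_all add: mult_ac)
    show ?thesis
      using wz_step[OF nz(1,2,6,4,5,3) bal' q P(4,2,3,1), of l j k i n] D
      unfolding 4 wz_term_swap(3)[of q a b c d e] wz_cert_swap(3)[of q a b c d e] wz_ratio_swap(3)[of q a b c d e]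
        den_swap(3)[of q a b c d e] N by blast
  qed
qed

section \<open>The terminating summation by telescoping\<close>

text \<open>Summing the WZ equation over \<open>k \<le> n\<close> leaves
  \<open>W (Suc n) - W 0\<close> with \<open>W 0 = 0\<close>, and the additional last term at level
  \<open>n + 1\<close> is \<open>- W (Suc n)\<close>. Hence the sum is multiplied by
  \<open>wz_ratio\<close> from one level to the next.\<close>

lemma terminating_sum:
  fixes nb nc nd ne :: "nat \<Rightarrow> nat"
  assumes nz: "q \<noteq> 0" "a \<noteq> 0" "b \<noteq> 0" "c \<noteq> 0" "d \<noteq> 0" "e \<noteq> 0"
    and bal: "b*c*d*e = q*a\<^sup>2"
    and q: "\<And>m. q^Suc m \<noteq> 1"
    and P: "\<And>m. q^Suc m*a \<noteq> b" "\<And>m. q^Suc m*a \<noteq> c" "\<And>m. q^Suc m*a \<noteq> d" "\<And>m. q^Suc m*a \<noteq> e"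
    and tot: "\<And>k. nb k + nc k + nd k + ne k = k"
    and mon: "\<And>k. nb k \<le> nb (Suc k)" "\<And>k. nc k \<le> nc (Suc k)" "\<And>k. nd k \<le> nd (Suc k)" "\<And>k. ne k \<le> ne (Suc k)"
    and D: "\<And>n k. k \<le> Suc n \<Longrightarrow> den q a b c d e n (nb k) (nc k) (nd k) (ne k) \<noteq> 0"
  shows "(\<Sum>k\<le>n. wz_term q a b c d e n (nb k) (nc k) (nd k) (ne k) (nb (Suc k)) (nc (Suc k)) (nd (Suc k)) (ne (Suc k)))
    = (qpoch q b n * qpoch q c n * qpoch q d n * qpoch q e n)
      / (qpoch q (q*a/b) n * qpoch q (q*a/c) n * qpoch q (q*a/d) n * qpoch q (q*a/e) n)"
proof (induction n)
  case 0
  have "nb 0 = 0" "nc 0 = 0" "nd 0 = 0" "ne 0 = 0" using tot[of 0] by auto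
  then show ?case using D[of 1 0] D[of 0 0]
    by (simp add: wz_term_def coef_def weight_def hyper_def qpoch_def) (simp add: den_def den1_def)
next
  case (Suc n)
  define T where "T n k = wz_term q a b c d e n (nb k) (nc k) (nd k) (ne k) (nb (Suc k)) (nc (Suc k)) (nd (Suc k)) (ne (Suc k))" for n k
  define W where "W k = wz_cert q a b c d e n (nb k) (nc k) (nd k) (ne k)" for k
  have st: "(den q a b c d e n (nb (Suc k)) (nc (Suc k)) (nd (Suc k)) (ne (Suc k)) \<noteq> 0 \<longrightarrow>
      T (Suc n) k - wz_ratio q a b c d e n * T n k = W (Suc k) - W k) \<and> (k = Suc n \<longrightarrow> T (Suc n) k = - W k)"
    if "k \<le> Suc n" for k
    unfolding T_def W_def
    using wz_step_any[OF nz bal q P, of "nb (Suc k)" "nc (Suc k)" "nd (Suc k)" "ne (Suc k)" "nb k" "nc k" "nd k" "ne k" n]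
      D[of k k] D[of k n] D[of "Suc k" "Suc n"] tot mon that by simp
  have "(\<Sum>k\<le>Suc n. T (Suc n) k) = (\<Sum>k\<le>n. wz_ratio q a b c d e n * T n k + (W (Suc k) - W k)) + T (Suc n) (Suc n)"
  proof -
    have "T (Suc n) k = wz_ratio q a b c d e n * T n k + (W (Suc k) - W k)" if "k \<le> n" for k
      using st[of k] D[of "Suc k" n] that by (simp add: diff_eq_eq add.commute)
    then show ?thesis by simp
  qed
  also have "\<dots> = wz_ratio q a b c d e n * (\<Sum>k\<le>n. T n k) + (W (Suc n) - W 0) - W (Suc n)"
    using st[of "Suc n"]
    by (simp add: sum.distrib sum_distrib_left lessThan_Suc_atMost[symmetric] sum_lessThan_telescope del: sum.lessThan_Suc)
  also have "W 0 = 0" by (simp add: W_def wz_cert_def tot)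
  finally have "(\<Sum>k\<le>Suc n. T (Suc n) k) = wz_ratio q a b c d e n * (\<Sum>k\<le>n. T n k)" by simp
  also have "\<dots> = wz_ratio q a b c d e n * ((qpoch q b n * qpoch q c n * qpoch q d n * qpoch q e n)
      / (qpoch q (q*a/b) n * qpoch q (q*a/c) n * qpoch q (q*a/d) n * qpoch q (q*a/e) n))"
    using Suc unfolding T_def by simp
  finally show ?case unfolding T_def wz_ratio_def qpoch_Suc by (simp add: mult_ac)
qed

section \<open>Uniform bounds and limits of q-products\<close>

lemma norm_prod_le_exp:
  fixes f :: "nat \<Rightarrow> complex"
  assumes "summable (\<lambda>i. norm (f i))" "finite A"
  shows "norm (\<Prod>i\<in>A. 1 + f i) \<le> exp (\<Sum>i. norm (f i))"
proof -
  have "norm (\<Prod>i\<in>A. 1 + f i) \<le> (\<Prod>i\<in>A. exp (norm (f i)))"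
    unfolding prod_norm[symmetric]
  proof (rule prod_mono, safe)
    fix i
    have "norm (1 + f i) \<le> 1 + norm (f i)" using norm_triangle_ineq[of 1 "f i"] by simp
    also have "\<dots> \<le> exp (norm (f i))" by (rule exp_ge_add_one_self)
    finally show "norm (1 + f i) \<le> exp (norm (f i))" .
  qed simp
  also have "\<dots> = exp (\<Sum>i\<in>A. norm (f i))" using assms(2) by (simp add: exp_sum)
  also have "\<dots> \<le> exp (\<Sum>i. norm (f i))"
    using sum_le_suminf[OF assms(1,2)] by simp
  finally show ?thesis .
qed

lemma prod_bounded:
  fixes q z :: complex
  assumes "norm q < 1"
  shows "\<exists>C>0. \<forall>A. finite A \<longrightarrow> norm (\<Prod>i\<in>A. 1 - z*q^i) \<le> C"
proof -
  have "summable (\<lambda>i. norm (- z*q^i))"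
    using assms by (simp add: norm_mult norm_power summable_mult summable_geometric)
  from norm_prod_le_exp[OF this] show ?thesis
    by (intro exI[of _ "exp (\<Sum>i. norm (- z*q^i))"]) simp
qed

text \<open>Each inverse factor is \<open>1 + f i\<close> with \<open>f\<close> absolutely summable,
  which bounds the product independently of \<open>A\<close>.\<close>

lemma inverse_prod_bounded:
  fixes q z :: complex
  assumes "norm q < 1"
  shows "\<exists>C>0. \<forall>A. finite A \<longrightarrow> norm (inverse (\<Prod>i\<in>A. 1 - z*q^i)) \<le> C"
proof -
  \<comment> \<open>If some factor in \<open>A\<close> is zero, the inverse of the product is
    \<open>0\<close> by convention; the value \<open>0\<close> chosen here for such \<open>i\<close>
    never enters a product.\<close>
  define f where "f i = (if 1 - z*q^i = 0 then 0 else inverse (1 - z*q^i) - 1)" for i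
  have lim: "(\<lambda>i. norm (1 - z*q^i)) \<longlonglongrightarrow> norm (1 - z*0)"
    by (intro tendsto_intros LIMSEQ_power_zero assms)
  have "eventually (\<lambda>i. 1/2 < norm (1 - z*q^i)) sequentially"
    by (rule order_tendstoD(1)[OF lim]) simp
  then have "eventually (\<lambda>i. norm (norm (f i)) \<le> 2 * norm z * norm q ^ i) sequentially"
  proof eventually_elim
    case (elim i)
    then have "1 - z*q^i \<noteq> 0" by auto
    then have "f i = z*q^i / (1 - z*q^i)" by (simp add: f_def divide_simps)
    then have "norm (f i) = norm z * norm q ^ i / norm (1 - z*q^i)"
      by (simp add: norm_divide norm_mult norm_power)
    also have "\<dots> \<le> norm z * norm q ^ i / (1/2)"
      using elim by (intro divide_left_mono) auto
    finally show ?case by simp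
  qed
  moreover have "summable (\<lambda>i. 2 * norm z * norm q ^ i)"
    using assms by (simp add: summable_mult summable_geometric)
  ultimately have sm: "summable (\<lambda>i. norm (f i))"
    by (rule summable_comparison_test_ev)
  have "norm (inverse (\<Prod>i\<in>A. 1 - z*q^i)) \<le> exp (\<Sum>i. norm (f i))" if "finite A" for A
  proof (cases "\<exists>i\<in>A. 1 - z*q^i = 0")
    case True
    then have "(\<Prod>i\<in>A. 1 - z*q^i) = 0" using that by auto
    then show ?thesis by simp
  next
    case False
    then have "inverse (\<Prod>i\<in>A. 1 - z*q^i) = (\<Prod>i\<in>A. 1 + f i)"
      unfolding prod_inversef[symmetric] comp_def by (intro prod.cong) (auto simp: f_def)
    then show ?thesis using norm_prod_le_exp[OF sm that] by simp
  qed
  then show ?thesis by (intro exI[of _ "exp (\<Sum>i. norm (f i))"]) simp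
qed

lemma Bseq_qpoch:
  assumes "norm q < 1"
  shows "Bseq (\<lambda>k. qpoch q x (m k))" and "Bseq (\<lambda>k. inverse (qpoch q x (m k)))"
proof -
  have *: "qpoch q x n = (\<Prod>i\<in>{..<n}. 1 - x*q^i)" for n by (simp add: qpoch_def mult.commute)
  show "Bseq (\<lambda>k. qpoch q x (m k))"
    using prod_bounded[OF assms, of x] unfolding * Bseq_def by blast
  show "Bseq (\<lambda>k. inverse (qpoch q x (m k)))"
    using inverse_prod_bounded[OF assms, of x] unfolding * Bseq_def by blast
qed

text \<open>A product over a finite set of exponents admits bounds uniform in \<open>n\<close> and
  \<open>m\<close>. Since \<open>m \<le> Suc n\<close>, the subtraction \<open>n - i\<close> never
  truncates.\<close>

lemma prod_shift_down:
  fixes q :: complex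
  assumes "q \<noteq> 0" "m \<le> Suc n"
  shows "(\<Prod>i<m. 1 - z*(q^n/q^i)) = (\<Prod>i\<in>(\<lambda>i. n - i) ` {..<m}. 1 - z*q^i)"
proof -
  have "inj_on (\<lambda>i. n - i) {..<m}" using assms by (auto simp: inj_on_def)
  moreover have "q^n/q^i = q^(n-i)" if "i < m" for i
    using that assms by (subst power_diff) auto
  ultimately show ?thesis by (simp add: prod.reindex)
qed

lemma prod_shift_up:
  fixes q :: complex
  shows "(\<Prod>i<m. 1 - z*q^n*q^i) = (\<Prod>i\<in>(\<lambda>i. n + i) ` {..<m}. 1 - z*q^i)"
  by (simp add: prod.reindex power_add mult_ac)

lemma inverse_den1_bounded:
  assumes "norm q < 1" "q \<noteq> 0"
  shows "\<exists>C>0. \<forall>n m. m \<le> Suc n \<longrightarrow> norm (inverse (den1 q a x n m)) \<le> C"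
proof -
  obtain C1 where C1: "C1 > 0" "\<And>A. finite A \<Longrightarrow> norm (inverse (\<Prod>i\<in>A. 1 - x*q^i)) \<le> C1"
    using inverse_prod_bounded[OF assms(1), of x] by blast
  obtain C2 where C2: "C2 > 0" "\<And>A. finite A \<Longrightarrow> norm (inverse (\<Prod>i\<in>A. 1 - a/x*q^i)) \<le> C2"
    using inverse_prod_bounded[OF assms(1), of "a/x"] by blast
  have "norm (inverse (den1 q a x n m)) \<le> C1*C2" if "m \<le> Suc n" for n m
    unfolding den1_def prod.distrib prod_shift_up prod_shift_down[OF assms(2) that] inverse_mult_distrib norm_mult
    using C1 C2 by (intro mult_mono) auto
  then show ?thesis using C1 C2 by (intro exI[of _ "C1*C2"]) auto
qed

lemma num_bounded:
  assumes "norm q < 1" "q \<noteq> 0"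
  shows "\<exists>C>0. \<forall>n m. m \<le> Suc n \<longrightarrow> norm (num q a n m) \<le> C"
proof -
  obtain C1 where C1: "C1 > 0" "\<And>A. finite A \<Longrightarrow> norm (\<Prod>i\<in>A. 1 - 1*q^i) \<le> C1"
    using prod_bounded[OF assms(1), of 1] by blast
  obtain C2 where C2: "C2 > 0" "\<And>A. finite A \<Longrightarrow> norm (\<Prod>i\<in>A. 1 - a*q^i) \<le> C2"
    using prod_bounded[OF assms(1), of a] by blast
  have "norm (num q a n m) \<le> C1*C2" if "m \<le> Suc n" for n m
    unfolding num_def prod.distrib prod_shift_up prod_shift_down[OF assms(2) that, of 1, unfolded mult_1] norm_mult
    using C1 C2 by (intro mult_mono) auto
  then show ?thesis using C1 C2 by (intro exI[of _ "C1*C2"]) auto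
qed

lemma den1_tendsto:
  assumes "norm q < 1"
  shows "(\<lambda>n. den1 q a x n m) \<longlonglongrightarrow> 1"
proof -
  have "(\<lambda>n. den1 q a x n m) \<longlonglongrightarrow> (\<Prod>i<m. (1 - x*0*q^i) * (1 - a/x*(0*inverse (q^i))))"
    unfolding den1_def divide_inverse[of "q^_"]
    by (intro tendsto_intros LIMSEQ_power_zero assms)
  then show ?thesis by simp
qed

lemma num_tendsto:
  assumes "norm q < 1"
  shows "(\<lambda>n. num q a n m) \<longlonglongrightarrow> 1"
proof -
  have "(\<lambda>n. num q a n m) \<longlonglongrightarrow> (\<Prod>i<m. (1 - 0*inverse (q^i)) * (1 - a*0*q^i))"
    unfolding num_def divide_inverse[of "q^_"]
    by (intro tendsto_intros LIMSEQ_power_zero assms)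
  then show ?thesis by simp
qed

lemma convergent_prod_qpoch:
  fixes q x :: complex
  assumes "norm q < 1"
  shows "convergent_prod (\<lambda>j. 1 - q^j*x)"
proof -
  have "summable (\<lambda>i. norm (1 - q^i*x - 1))"
    using assms by (simp add: norm_mult norm_power summable_mult2 summable_geometric)
  then show ?thesis
    by (intro abs_convergent_prod_imp_convergent_prod summable_imp_abs_convergent_prod)
qed

lemma qpoch_tendsto:
  assumes "norm q < 1"
  shows "qpoch q x \<longlonglongrightarrow> qpoch_inf q x"
proof -
  have "(\<lambda>n. qpoch q x (Suc n)) \<longlonglongrightarrow> qpoch_inf q x"
    using convergent_prod_LIMSEQ[OF convergent_prod_qpoch[OF assms, of x]]
    unfolding qpoch_def qpoch_inf_def lessThan_Suc_atMost .
  then show ?thesis by (simp only: filterlim_sequentially_Suc)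
qed

text \<open>A convergent infinite product with a zero factor is zero.\<close>

lemma qpoch_inf_factor_nonzero:
  assumes "norm q < 1" "qpoch_inf q x \<noteq> 0"
  shows "1 - q^j*x \<noteq> 0"
  using assms has_prod_zeroI[OF convergent_prod_has_prod[OF convergent_prod_qpoch[OF assms(1)]]]
  unfolding qpoch_inf_def by blast

lemma Bseq_tendsto_0_mult:
  fixes f g :: "nat \<Rightarrow> complex"
  assumes "f \<longlonglongrightarrow> 0" "Bseq g"
  shows "(\<lambda>n. f n * g n) \<longlonglongrightarrow> 0"
  using bounded_bilinear.Zfun_prod_Bfun[OF bounded_bilinear_mult, of f sequentially g] assms
  by (simp add: tendsto_Zfun_iff)

section \<open>Passage to the limit by Tannery's theorem\<close>

lemma nonterminating_sum:
  fixes nb nc nd ne :: "nat \<Rightarrow> nat"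
  assumes nz: "q \<noteq> 0" "a \<noteq> 0" "b \<noteq> 0" "c \<noteq> 0" "d \<noteq> 0" "e \<noteq> 0"
    and bal: "b*c*d*e = q*a\<^sup>2"
    and q: "norm q < 1"
    and P: "qpoch_inf q (q*a/b) \<noteq> 0" "qpoch_inf q (q*a/c) \<noteq> 0" "qpoch_inf q (q*a/d) \<noteq> 0" "qpoch_inf q (q*a/e) \<noteq> 0"
    and tot: "\<And>k. nb k + nc k + nd k + ne k = k"
    and mon: "\<And>k. nb k \<le> nb (Suc k)" "\<And>k. nc k \<le> nc (Suc k)" "\<And>k. nd k \<le> nd (Suc k)" "\<And>k. ne k \<le> ne (Suc k)"
    and D: "\<And>n k. k \<le> Suc n \<Longrightarrow> den q a b c d e n (nb k) (nc k) (nd k) (ne k) \<noteq> 0"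
  defines "t \<equiv> \<lambda>k. coef q a b c d e (nb k) (nc k) (nd k) (ne k)
     * (den q a b c d e k (nb (Suc k)) (nc (Suc k)) (nd (Suc k)) (ne (Suc k))
        / den q a b c d e k (nb k) (nc k) (nd k) (ne k))"
  assumes sm: "summable (\<lambda>k. norm (t k))"
  shows "(\<Sum>k. t k) = (qpoch_inf q b * qpoch_inf q c * qpoch_inf q d * qpoch_inf q e)
      / (qpoch_inf q (q*a/b) * qpoch_inf q (q*a/c) * qpoch_inf q (q*a/d) * qpoch_inf q (q*a/e))"
proof -
  have P': "q^Suc m*a \<noteq> x" if "qpoch_inf q (q*a/x) \<noteq> 0" "x \<noteq> 0" for m x
    using qpoch_inf_factor_nonzero[OF q that(1), of m] that(2) by (simp add: field_simps)
  have q1: "q^Suc m \<noteq> 1" for m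
  proof
    assume "q^Suc m = 1"
    then have "norm q ^ Suc m = 1" by (metis norm_one norm_power)
    then show False using q nz(1) power_Suc_less_one[of "norm q" m] by simp
  qed
  \<comment> \<open>The factor by which the \<open>k\<close>-th terminating summand differs from
    \<open>t k\<close>: bounded uniformly for \<open>k \<le> n\<close>, with limit \<open>1\<close>
    as \<open>n\<close> grows.\<close>
  define r where "r k n = num q a n k / den q a b c d e n (nb (Suc k)) (nc (Suc k)) (nd (Suc k)) (ne (Suc k))" for k n
  have wz_term: "wz_term q a b c d e n (nb k) (nc k) (nd k) (ne k) (nb (Suc k)) (nc (Suc k)) (nd (Suc k)) (ne (Suc k))
      = t k * r k n" for n k
    unfolding wz_term_def t_def r_def tot by simp
  have le: "nb k \<le> k" "nc k \<le> k" "nd k \<le> k" "ne k \<le> k" for k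
    using tot[of k] by linarith+
  obtain Cb where Cb: "Cb > 0" "\<And>n m. m \<le> Suc n \<Longrightarrow> norm (inverse (den1 q a b n m)) \<le> Cb"
    using inverse_den1_bounded[OF q nz(1), of a b] by blast
  obtain Cc where Cc: "Cc > 0" "\<And>n m. m \<le> Suc n \<Longrightarrow> norm (inverse (den1 q a c n m)) \<le> Cc"
    using inverse_den1_bounded[OF q nz(1), of a c] by blast
  obtain Cd where Cd: "Cd > 0" "\<And>n m. m \<le> Suc n \<Longrightarrow> norm (inverse (den1 q a d n m)) \<le> Cd"
    using inverse_den1_bounded[OF q nz(1), of a d] by blast
  obtain Ce where Ce: "Ce > 0" "\<And>n m. m \<le> Suc n \<Longrightarrow> norm (inverse (den1 q a e n m)) \<le> Ce"
    using inverse_den1_bounded[OF q nz(1), of a e] by blast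
  obtain Cn where Cn: "Cn > 0" "\<And>n m. m \<le> Suc n \<Longrightarrow> norm (num q a n m) \<le> Cn"
    using num_bounded[OF q nz(1), of a] by blast
  define C where "C = Cn * (Cb * Cc * Cd * Ce)"
  have rb: "norm (r k n) \<le> C" if "k \<le> n" for k n
  proof -
    have le': "nb (Suc k) \<le> Suc n" "nc (Suc k) \<le> Suc n" "nd (Suc k) \<le> Suc n" "ne (Suc k) \<le> Suc n"
      using le[of "Suc k"] that by linarith+
    have "norm (r k n) = norm (num q a n k) * (norm (inverse (den1 q a b n (nb (Suc k))))
       * norm (inverse (den1 q a c n (nc (Suc k)))) * norm (inverse (den1 q a d n (nd (Suc k))))
       * norm (inverse (den1 q a e n (ne (Suc k)))))"
      unfolding r_def den_def divide_inverse inverse_mult_distrib norm_mult ..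
    also have "\<dots> \<le> C" unfolding C_def
      using le' that by (intro mult_mono Cn Cb Cc Cd Ce mult_nonneg_nonneg norm_ge_zero)
        (auto intro: less_imp_le Cn Cb Cc Cd Ce)
    finally show ?thesis .
  qed
  have rl: "(\<lambda>n. r k n) \<longlonglongrightarrow> 1" for k
  proof -
    have "(\<lambda>n. r k n) \<longlonglongrightarrow> 1 / (1 * 1 * 1 * 1)"
      unfolding r_def den_def by (intro tendsto_intros num_tendsto den1_tendsto q) simp
    then show ?thesis by simp
  qed
  \<comment> \<open>The cut at \<open>k \<le> n\<close> leaves the terminating sum unchanged and
    keeps to the range in which \<open>rb\<close> bounds \<open>r\<close>.\<close>
  define f where "f k n = (if k \<le> n then t k * r k n else 0)" for k n
  have "((\<lambda>n. suminf (\<lambda>k. f k n)) \<longlonglongrightarrow> suminf t)"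
  proof (rule tannerys_theorem[THEN conjunct2, THEN conjunct2])
    show "(\<lambda>n. f k n) \<longlonglongrightarrow> t k" for k
    proof -
      have "(\<lambda>n. t k * r k n) \<longlonglongrightarrow> t k * 1" by (intro tendsto_intros rl)
      moreover have "eventually (\<lambda>n. t k * r k n = f k n) sequentially"
        using eventually_ge_at_top[of k] by eventually_elim (simp add: f_def)
      ultimately show ?thesis by (simp add: filterlim_cong)
    qed
    show "eventually (\<lambda>(k,n). norm (f k n) \<le> norm (t k) * C) (at_top \<times>\<^sub>F sequentially)"
    proof (rule always_eventually, safe)
      fix k n
      have "0 \<le> C" using Cn(1) Cb(1) Cc(1) Cd(1) Ce(1) by (simp add: C_def)
      then show "norm (f k n) \<le> norm (t k) * C"
        using rb[of k n] by (auto simp: f_def norm_mult intro!: mult_left_mono)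
    qed
    show "summable (\<lambda>k. norm (t k) * C)" by (intro summable_mult2 sm)
  qed simp
  moreover have "suminf (\<lambda>k. f k n) = (qpoch q b n * qpoch q c n * qpoch q d n * qpoch q e n)
      / (qpoch q (q*a/b) n * qpoch q (q*a/c) n * qpoch q (q*a/d) n * qpoch q (q*a/e) n)" for n
  proof -
    have "suminf (\<lambda>k. f k n) = (\<Sum>k\<le>n. f k n)"
      by (rule suminf_finite) (auto simp: f_def)
    also have "\<dots> = (\<Sum>k\<le>n. t k * r k n)" by (intro sum.cong) (auto simp: f_def)
    also have "\<dots> = (qpoch q b n * qpoch q c n * qpoch q d n * qpoch q e n)
      / (qpoch q (q*a/b) n * qpoch q (q*a/c) n * qpoch q (q*a/d) n * qpoch q (q*a/e) n)"
      unfolding wz_term[symmetric]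
      by (rule terminating_sum[OF nz bal q1 P'[OF P(1) nz(3)] P'[OF P(2) nz(4)] P'[OF P(3) nz(5)] P'[OF P(4) nz(6)] tot mon D])
    finally show ?thesis .
  qed
  ultimately have "(\<lambda>n. (qpoch q b n * qpoch q c n * qpoch q d n * qpoch q e n)
      / (qpoch q (q*a/b) n * qpoch q (q*a/c) n * qpoch q (q*a/d) n * qpoch q (q*a/e) n)) \<longlonglongrightarrow> suminf t"
    by simp
  moreover have "(\<lambda>n. (qpoch q b n * qpoch q c n * qpoch q d n * qpoch q e n)
      / (qpoch q (q*a/b) n * qpoch q (q*a/c) n * qpoch q (q*a/d) n * qpoch q (q*a/e) n))
    \<longlonglongrightarrow> (qpoch_inf q b * qpoch_inf q c * qpoch_inf q d * qpoch_inf q e)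
      / (qpoch_inf q (q*a/b) * qpoch_inf q (q*a/c) * qpoch_inf q (q*a/d) * qpoch_inf q (q*a/e))"
    using P by (intro tendsto_intros qpoch_tendsto q) auto
  ultimately show ?thesis by (rule LIMSEQ_unique)
qed

section \<open>Decay of the weight and size of the hypergeometric factor\<close>

lemma weight_Suc:
  "weight q a b c d e (Suc i) j k l = weight q a b c d e i j k l * (a/b * q^(j+k+l))"
  "weight q a b c d e i (Suc j) k l = weight q a b c d e i j k l * (a/c * q^(i+k+l))"
  "weight q a b c d e i j (Suc k) l = weight q a b c d e i j k l * (a/d * q^(i+j+l))"
  "weight q a b c d e i j k (Suc l) = weight q a b c d e i j k l * (a/e * q^(i+j+k))"
  unfolding weight_def by (simp_all add: power_add)

text \<open>A step in direction \<open>b\<close> multiplies the weight by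
  \<open>(a/b) * q^(k - nb k)\<close>, and similarly for the other directions. By \<open>lim\<close>
  all four ratios tend to \<open>0\<close>, so the ratio test applies.\<close>

lemma summable_weight:
  fixes nb nc nd ne :: "nat \<Rightarrow> nat"
  assumes q: "norm q < 1"
    and tot: "\<And>k. nb k + nc k + nd k + ne k = k"
    and mon: "\<And>k. nb k \<le> nb (Suc k)" "\<And>k. nc k \<le> nc (Suc k)" "\<And>k. nd k \<le> nd (Suc k)" "\<And>k. ne k \<le> ne (Suc k)"
    and lim: "filterlim (\<lambda>k. k - nb k) at_top sequentially" "filterlim (\<lambda>k. k - nc k) at_top sequentially"
      "filterlim (\<lambda>k. k - nd k) at_top sequentially" "filterlim (\<lambda>k. k - ne k) at_top sequentially"
  shows "summable (\<lambda>k. norm (weight q a b c d e (nb k) (nc k) (nd k) (ne k)))"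
proof -
  have ev: "eventually (\<lambda>k. norm (z * q^(m k)) \<le> 1/2) sequentially"
    if "filterlim m at_top sequentially" for z and m :: "nat \<Rightarrow> nat"
  proof -
    have "(\<lambda>k. q^(m k)) \<longlonglongrightarrow> 0"
      using filterlim_compose[OF LIMSEQ_power_zero[OF q] that] .
    then have "(\<lambda>k. norm (z * q^(m k))) \<longlonglongrightarrow> norm (z * 0)" by (intro tendsto_intros)
    then have "eventually (\<lambda>k. norm (z * q^(m k)) < 1/2) sequentially"
      by (rule order_tendstoD(2)) simp
    then show ?thesis by eventually_elim simp
  qed
  have "eventually (\<lambda>k. norm (weight q a b c d e (nb (Suc k)) (nc (Suc k)) (nd (Suc k)) (ne (Suc k)))
     \<le> 1/2 * norm (weight q a b c d e (nb k) (nc k) (nd k) (ne k))) sequentially"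
    using ev[OF lim(1), of "a/b"] ev[OF lim(2), of "a/c"] ev[OF lim(3), of "a/d"] ev[OF lim(4), of "a/e"]
  proof eventually_elim
    case (elim k)
    have s: "k - nb k = nc k + nd k + ne k" "k - nc k = nb k + nd k + ne k"
      "k - nd k = nb k + nc k + ne k" "k - ne k = nb k + nc k + nd k" using tot[of k] by linarith+
    have *: "norm (w * z) \<le> 1/2 * norm w" if "norm z \<le> 1/2" for w z :: complex
      using mult_left_mono[OF that norm_ge_zero[of w]] by (simp add: norm_mult)
    consider "nb (Suc k) = Suc (nb k)" "nc (Suc k) = nc k" "nd (Suc k) = nd k" "ne (Suc k) = ne k"
      | "nb (Suc k) = nb k" "nc (Suc k) = Suc (nc k)" "nd (Suc k) = nd k" "ne (Suc k) = ne k"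
      | "nb (Suc k) = nb k" "nc (Suc k) = nc k" "nd (Suc k) = Suc (nd k)" "ne (Suc k) = ne k"
      | "nb (Suc k) = nb k" "nc (Suc k) = nc k" "nd (Suc k) = nd k" "ne (Suc k) = Suc (ne k)"
      using tot[of k] tot[of "Suc k"] mon[of k] by linarith
    then show ?case
      using elim unfolding s by cases (simp_all only: weight_Suc *)
  qed
  then obtain N where "\<And>k. N \<le> k \<Longrightarrow> norm (weight q a b c d e (nb (Suc k)) (nc (Suc k)) (nd (Suc k)) (ne (Suc k)))
     \<le> 1/2 * norm (weight q a b c d e (nb k) (nc k) (nd k) (ne k))"
    unfolding eventually_sequentially by blast
  then show ?thesis by (intro summable_ratio_test[of "1/2" N]) simp_all
qed

text \<open>Dividing by \<open>h\<close>, whose inverse is bounded, and by the last factor, which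
  tends to \<open>1 - z\<close>, leaves powers of \<open>z\<close> that tend to \<open>0\<close>.
  This is done along multiples of \<open>L\<close>, where \<open>h\<close> is known not to
  vanish.\<close>

lemma norm_less_one_of_geometric_tendsto_0:
  fixes z x q :: complex
  assumes lim: "(\<lambda>k. z^k * h k * ((1 - x*q^k*q^k) * (1 - z))) \<longlonglongrightarrow> 0"
    and h: "Bseq (\<lambda>k. inverse (h k))" "\<And>k. h (k*L) \<noteq> 0"
    and "1 \<le> L" "z \<noteq> 1" "norm q < 1"
  shows "norm z < 1"
proof (rule ccontr)
  assume "\<not> norm z < 1"
  then have z: "1 \<le> norm z ^ k" for k by (simp add: one_le_power)
  have sub: "filterlim (\<lambda>k. k*L) at_top sequentially"
    using assms(4) by (intro filterlim_subseq) (auto simp: strict_mono_def)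
  have "(\<lambda>k. z^k * h k * ((1 - x*q^k*q^k) * (1 - z)) * inverse (h k)) \<longlonglongrightarrow> 0"
    by (rule Bseq_tendsto_0_mult[OF lim h(1)])
  from filterlim_compose[OF this sub]
  have "(\<lambda>k. z^(k*L) * h (k*L) * ((1 - x*q^(k*L)*q^(k*L)) * (1 - z)) * inverse (h (k*L))) \<longlonglongrightarrow> 0" .
  moreover have "(\<lambda>k. inverse ((1 - x*q^(k*L)*q^(k*L)) * (1 - z))) \<longlonglongrightarrow> inverse ((1 - x*0*0) * (1 - z))"
    using filterlim_compose[OF LIMSEQ_power_zero[OF assms(6)] sub] assms(5) by (intro tendsto_intros) auto
  ultimately have "(\<lambda>k. z^(k*L) * h (k*L) * ((1 - x*q^(k*L)*q^(k*L)) * (1 - z)) * inverse (h (k*L))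
      * inverse ((1 - x*q^(k*L)*q^(k*L)) * (1 - z))) \<longlonglongrightarrow> 0 * inverse ((1 - x*0*0) * (1 - z))"
    by (rule tendsto_mult)
  moreover have "eventually (\<lambda>k. 1/2 < norm (1 - x*q^(k*L)*q^(k*L))) sequentially"
  proof -
    have "(\<lambda>k. norm (1 - x*q^(k*L)*q^(k*L))) \<longlonglongrightarrow> norm (1 - x*0*0)"
      using filterlim_compose[OF LIMSEQ_power_zero[OF assms(6)] sub] by (intro tendsto_intros) auto
    then show ?thesis by (rule order_tendstoD(1)) simp
  qed
  then have "eventually (\<lambda>k. z^(k*L) * h (k*L) * ((1 - x*q^(k*L)*q^(k*L)) * (1 - z)) * inverse (h (k*L))
      * inverse ((1 - x*q^(k*L)*q^(k*L)) * (1 - z)) = z^(k*L)) sequentially"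
  proof eventually_elim
    case (elim k)
    then have "1 - x*q^(k*L)*q^(k*L) \<noteq> 0" by auto
    then have g: "(1 - x*q^(k*L)*q^(k*L)) * (1 - z) \<noteq> 0" using assms(5) by simp
    have "z^(k*L) * h (k*L) * u * inverse (h (k*L)) * inverse u = z^(k*L)" if "u \<noteq> 0" for u
      using that h(2)[of k] by (simp add: field_simps)
    from this[OF g] show ?case .
  qed
  ultimately have "(\<lambda>k. z^(k*L)) \<longlonglongrightarrow> 0 * inverse ((1 - x*0*0) * (1 - z))"
    by (rule Lim_transform_eventually)
  then have "(\<lambda>k. z^(k*L)) \<longlonglongrightarrow> 0" by simp
  then have "(\<lambda>k. norm (z^(k*L))) \<longlonglongrightarrow> 0" by (rule tendsto_norm_zero)
  from order_tendstoD(2)[OF this, of 1]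
  have "eventually (\<lambda>k. norm (z^(k*L)) < 1) sequentially" by simp
  then obtain k where "norm (z^(k*L)) < 1" by (auto simp: eventually_sequentially)
  then show False using z[of "k*L"] by (simp add: norm_power)
qed

text \<open>Every q-Pochhammer factor is bounded and has bounded inverse. The second claim keeps
  \<open>hyper\<close> away from \<open>0\<close> wherever it is nonzero.\<close>

lemma Bseq_hyper:
  assumes "norm q < 1"
  shows "Bseq (\<lambda>n. hyper q a b c d e (i n) (j n) (k n) (l n))"
    and "Bseq (\<lambda>n. inverse (hyper q a b c d e (i n) (j n) (k n) (l n)))"
  unfolding hyper_def divide_inverse inverse_mult_distrib inverse_inverse_eq
  by (intro Bseq_mult Bseq_qpoch assms)+

section \<open>Translation of \<phi>, \<Theta> and H into the symmetric encoding\<close>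

text \<open>The factor extracted when each \<open>1 - y\<close> in \<open>(x/(a q^n); q)_m\<close>
  is rewritten as \<open>- y * (1 - 1/y)\<close>.\<close>

definition pair_scale :: "complex \<Rightarrow> complex \<Rightarrow> complex \<Rightarrow> nat \<Rightarrow> nat \<Rightarrow> complex" where
  "pair_scale q a x n m = (\<Prod>i<m. - (x/a) * (q^i/q^n))"

lemma qpoch_pair:
  assumes "q \<noteq> 0" "a \<noteq> 0" "x \<noteq> 0"
  shows "qpoch q (x*q^n) m * qpoch q (x/(a*q^n)) m = den1 q a x n m * pair_scale q a x n m"
  unfolding qpoch_def den1_def pair_scale_def prod.distrib[symmetric]
  by (intro prod.cong) (use assms in \<open>auto simp: field_simps\<close>)

lemma pair_scale_nonzero: "q \<noteq> 0 \<Longrightarrow> a \<noteq> 0 \<Longrightarrow> x \<noteq> 0 \<Longrightarrow> pair_scale q a x n m \<noteq> 0"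
  by (simp add: pair_scale_def)

lemma pair_scale_Suc: "pair_scale q a x n (Suc m) = pair_scale q a x n m * (- (x/a) * (q^m/q^n))"
  by (simp add: pair_scale_def)

lemma phi_den:
  assumes "q \<noteq> 0" "a \<noteq> 0" "b \<noteq> 0" "c \<noteq> 0" "d \<noteq> 0"
  defines "e \<equiv> q*a\<^sup>2/(b*c*d)"
  shows "phi q a b c d nb nc nd ne (q^n) k = den q a b c d e n (nb k) (nc k) (nd k) (ne k)
     * (pair_scale q a b n (nb k) * pair_scale q a c n (nc k) * pair_scale q a d n (nd k) * pair_scale q a e n (ne k))"
proof -
  have e: "e \<noteq> 0" using assms by simp
  have e1: "q*a\<^sup>2*q^n/(b*c*d) = e*q^n" and e2: "q*a/(b*c*d*q^n) = e/(a*q^n)"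
    using assms(2) by (simp_all add: e_def power2_eq_square)
  have "phi q a b c d nb nc nd ne (q^n) k
     = (qpoch q (b*q^n) (nb k) * qpoch q (b/(a*q^n)) (nb k))
      * (qpoch q (c*q^n) (nc k) * qpoch q (c/(a*q^n)) (nc k))
      * (qpoch q (d*q^n) (nd k) * qpoch q (d/(a*q^n)) (nd k))
      * (qpoch q (e*q^n) (ne k) * qpoch q (e/(a*q^n)) (ne k))"
    unfolding phi_def e1 e2 by (simp only: mult_ac)
  then show ?thesis
    unfolding qpoch_pair[OF assms(1,2,3)] qpoch_pair[OF assms(1,2,4)] qpoch_pair[OF assms(1,2,5)]
      qpoch_pair[OF assms(1,2) e] den_def by (simp only: mult_ac)
qed

lemma int_choose_two_add: "int ((m + n) choose 2) = int (m choose 2) + int (n choose 2) + int m * int n"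
proof (induction n)
  case (Suc n)
  have "Suc r choose 2 = (r choose 2) + r" for r by (simp add: numeral_2_eq_2)
  with Suc show ?case by (simp add: algebra_simps)
qed simp

text \<open>Because \<open>m\<close> is the sum of the four indices, the difference of binomials is
  the sum of their pairwise products. The exponent is thus a natural number and \<open>powi\<close>
  becomes an ordinary power.\<close>

lemma Theta_weight:
  assumes "a \<noteq> 0" "q \<noteq> 0" and tot: "nb m + nc m + nd m + ne m = m"
  shows "Theta q a b c d nb nc nd ne m = weight q a b c d (q*a\<^sup>2/(b*c*d)) (nb m) (nc m) (nd m) (ne m)"
proof -
  have "int (m choose 2) - int (nb m choose 2) - int (nc m choose 2)
               - int (nd m choose 2) - int (ne m choose 2)
      = int (nb m*nc m + nb m*nd m + nb m*ne m + nc m*nd m + nc m*ne m + nd m*ne m)"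
    by (subst tot[symmetric]) (simp add: int_choose_two_add algebra_simps)
  moreover have "b*c*d/(q*a) = a/(q*a\<^sup>2/(b*c*d))"
    using assms by (simp add: power2_eq_square)
  ultimately show ?thesis unfolding Theta_def weight_def by (simp only: power_int_of_nat mult.assoc)
qed

text \<open>With \<open>e = q a^2/(bcd)\<close> one has \<open>bcd/a = qa/e\<close> and
  \<open>qa/(bc) = de/a\<close>, and likewise for the other pairs.\<close>

lemma H_hyper:
  assumes "q \<noteq> 0" "a \<noteq> 0" "b \<noteq> 0" "c \<noteq> 0" "d \<noteq> 0" and tot: "nb m + nc m + nd m + ne m = m"
  shows "H_fun q a b c d nb nc nd ne m = hyper q a b c d (q*a\<^sup>2/(b*c*d)) (nb m) (nc m) (nd m) (ne m)"
proof -
  define e where "e = q*a\<^sup>2/(b*c*d)"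
  have *: "b*c*d/a = q*a/e" "q*a/(b*c) = d*e/a" "q*a/(b*d) = c*e/a" "q*a/(c*d) = b*e/a"
    using assms by (simp_all add: e_def power2_eq_square field_simps)
  show ?thesis
    unfolding H_fun_def hyper_def * e_def[symmetric] tot times_divide_times_eq by (simp only: mult_ac)
qed

section \<open>Absolute convergence of the series\<close>

text \<open>A step adds one pair of factors, with \<open>q^(n+m)\<close> and \<open>q^(n-m)\<close>;
  both powers have norm at most \<open>1\<close> as \<open>m \<le> n\<close>.\<close>

lemma ratio_den1_bounded:
  assumes "norm q < 1" "q \<noteq> 0" "m \<le> n" "m' = m \<or> m' = Suc m"
  shows "norm (den1 q a x n m' / den1 q a x n m) \<le> (1 + norm x) * (1 + norm (a/x))"
proof -
  have ge: "1 \<le> (1 + norm x) * (1 + norm (a/x))"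
    using mult_mono[of 1 "1 + norm x" 1 "1 + norm (a/x)"] by simp
  show ?thesis
  proof (cases "m' = m \<or> den1 q a x n m = 0")
    case True
    then show ?thesis using ge by (cases "den1 q a x n m = 0") auto
  next
    case False
    then have "norm (den1 q a x n m' / den1 q a x n m)
      = norm (1 - x*q^(n+m)) * norm (1 - a/x*q^(n-m))"
      using assms by (auto simp: den1_Suc power_diff power_add norm_mult mult.assoc)
    also have "\<dots> \<le> (1 + norm x) * (1 + norm (a/x))"
    proof -
      have "norm (1 - z*q^r) \<le> 1 + norm z" for z r
      proof -
        have "norm (1 - z*q^r) \<le> 1 + norm (z*q^r)" using norm_triangle_ineq4[of 1 "z*q^r"] by simp
        also have "norm (z*q^r) \<le> norm z * 1"
          unfolding norm_mult norm_power using assms(1)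
          by (intro mult_left_mono power_le_one) auto
        finally show ?thesis by simp
      qed
      note le = this
      show ?thesis by (intro mult_mono le) auto
    qed
    finally show ?thesis .
  qed
qed

text \<open>Covers a path that runs along one axis. The quotient of the \<open>den1\<close> is then
  \<open>(1 - x*q^k*q^k) * (1 - a/x)\<close>, so terms tending to \<open>0\<close> force
  \<open>a/x\<close> into the unit disc.\<close>

lemma summable_powers:
  fixes q a x :: complex
  assumes q: "norm q < 1" "q \<noteq> 0"
    and D: "\<And>n k. k \<le> Suc n \<Longrightarrow> den1 q a x n k \<noteq> 0"
    and h: "Bseq (\<lambda>k. inverse (h k))" "\<And>k. h (k*L) \<noteq> 0" "1 \<le> L"
    and lim: "(\<lambda>k. (a/x)^k * h k * (den1 q a x k (Suc k) / den1 q a x k k)) \<longlonglongrightarrow> 0"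
  shows "summable (\<lambda>k. norm ((a/x)^k))"
proof -
  have "den1 q a x k (Suc k) / den1 q a x k k = (1 - x*q^k*q^k) * (1 - a/x)" for k
    using D[of k k] q(2) by (simp add: den1_Suc)
  with lim have "(\<lambda>k. (a/x)^k * h k * ((1 - x*q^k*q^k) * (1 - a/x))) \<longlonglongrightarrow> 0" by simp
  \<comment> \<open>For \<open>n = 0\<close> and one factor pair, \<open>den1\<close> contains
    \<open>1 - a/x\<close>.\<close>
  moreover have "a/x \<noteq> 1" using D[of 1 0] by (auto simp: den1_def)
  ultimately have "norm (a/x) < 1"
    by (rule norm_less_one_of_geometric_tendsto_0[OF _ h _ q(1)])
  then show ?thesis by (simp add: norm_power summable_geometric)
qed

text \<open>The terms are \<open>w k * h k * v k\<close> with \<open>h\<close> and \<open>v\<close>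
  bounded, so it suffices to sum the weights absolutely. By \<open>dichotomy\<close> either all four
  gaps such as \<open>k - nb k\<close> tend to infinity or the path stays on one axis.\<close>

lemma summable_norm_term:
  fixes nb nc nd ne :: "nat \<Rightarrow> nat"
  assumes nz: "q \<noteq> 0" and q: "norm q < 1"
    and tot: "\<And>k. nb k + nc k + nd k + ne k = k"
    and mon: "\<And>k. nb k \<le> nb (Suc k)" "\<And>k. nc k \<le> nc (Suc k)" "\<And>k. nd k \<le> nd (Suc k)" "\<And>k. ne k \<le> ne (Suc k)"
    and dichotomy: "filterlim (\<lambda>k. k - nb k) at_top sequentially \<or> (\<forall>k. nb k = k)"
      "filterlim (\<lambda>k. k - nc k) at_top sequentially \<or> (\<forall>k. nc k = k)"
      "filterlim (\<lambda>k. k - nd k) at_top sequentially \<or> (\<forall>k. nd k = k)"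
      "filterlim (\<lambda>k. k - ne k) at_top sequentially \<or> (\<forall>k. ne k = k)"
    and D: "\<And>n k. k \<le> Suc n \<Longrightarrow> den q a b c d e n (nb k) (nc k) (nd k) (ne k) \<noteq> 0"
    and H: "1 \<le> L" "\<And>k. hyper q a b c d e (nb (k*L)) (nc (k*L)) (nd (k*L)) (ne (k*L)) \<noteq> 0"
  defines "t \<equiv> \<lambda>k. coef q a b c d e (nb k) (nc k) (nd k) (ne k)
     * (den q a b c d e k (nb (Suc k)) (nc (Suc k)) (nd (Suc k)) (ne (Suc k))
        / den q a b c d e k (nb k) (nc k) (nd k) (ne k))"
  assumes sm: "summable t"
  shows "summable (\<lambda>k. norm (t k))"
proof -
  define w where "w k = weight q a b c d e (nb k) (nc k) (nd k) (ne k)" for k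
  define h where "h k = hyper q a b c d e (nb k) (nc k) (nd k) (ne k)" for k
  define v where "v k = den q a b c d e k (nb (Suc k)) (nc (Suc k)) (nd (Suc k)) (ne (Suc k))
        / den q a b c d e k (nb k) (nc k) (nd k) (ne k)" for k
  have t: "t k = w k * h k * v k" for k
    unfolding t_def w_def h_def v_def coef_def ..
  have t0: "(\<lambda>k. w k * h k * v k) \<longlonglongrightarrow> 0" using summable_LIMSEQ_zero[OF sm] unfolding t .
  have h: "Bseq h" "Bseq (\<lambda>k. inverse (h k))" "h (k*L) \<noteq> 0" for k
    unfolding h_def using H Bseq_hyper[OF q] by auto
  have le: "nb k \<le> k" "nc k \<le> k" "nd k \<le> k" "ne k \<le> k" for k
    using tot[of k] by linarith+
  have inc: "nb (Suc k) = nb k \<or> nb (Suc k) = Suc (nb k)" "nc (Suc k) = nc k \<or> nc (Suc k) = Suc (nc k)"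
    "nd (Suc k) = nd k \<or> nd (Suc k) = Suc (nd k)" "ne (Suc k) = ne k \<or> ne (Suc k) = Suc (ne k)" for k
    using tot[of k] tot[of "Suc k"] mon[of k] by linarith+
  have "Bseq v"
  proof (rule BseqI')
    fix k
    have "norm (v k) = norm (den1 q a b k (nb (Suc k)) / den1 q a b k (nb k))
      * norm (den1 q a c k (nc (Suc k)) / den1 q a c k (nc k))
      * norm (den1 q a d k (nd (Suc k)) / den1 q a d k (nd k))
      * norm (den1 q a e k (ne (Suc k)) / den1 q a e k (ne k))"
      unfolding v_def den_def by (simp add: norm_mult norm_divide)
    also have "\<dots> \<le> ((1 + norm b) * (1 + norm (a/b))) * ((1 + norm c) * (1 + norm (a/c)))
        * ((1 + norm d) * (1 + norm (a/d))) * ((1 + norm e) * (1 + norm (a/e)))"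
      by (intro mult_mono ratio_den1_bounded q nz le inc mult_nonneg_nonneg norm_ge_zero) auto
    finally show "norm (v k) \<le> \<dots>" .
  qed
  then have "Bseq (\<lambda>k. h k * v k)" by (intro Bseq_mult h)
  then obtain K where K: "\<And>k. norm (h k * v k) \<le> K" by (auto simp: Bseq_def)
  have sw: "summable (\<lambda>k. norm (w k))"
  proof (cases "filterlim (\<lambda>k. k - nb k) at_top sequentially \<and> filterlim (\<lambda>k. k - nc k) at_top sequentially
     \<and> filterlim (\<lambda>k. k - nd k) at_top sequentially \<and> filterlim (\<lambda>k. k - ne k) at_top sequentially")
    case True
    then show ?thesis unfolding w_def by (intro summable_weight q tot mon) auto
  next
    case False
    then consider "\<forall>k. nb k = k" | "\<forall>k. nc k = k" | "\<forall>k. nd k = k" | "\<forall>k. ne k = k"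
      using dichotomy by blast
    then show ?thesis
    proof cases
      case 1
      then have s: "nb k = k" "nc k = 0" "nd k = 0" "ne k = 0" for k using tot[of k] by auto
      have w: "w k = (a/b)^k" for k by (simp add: w_def s weight_def)
      have v: "v k = den1 q a b k (Suc k) / den1 q a b k k" for k
        by (simp add: v_def s den_def) (simp add: den1_def)
      show ?thesis using summable_powers[OF q nz _ h(2,3) H(1), of a b] D t0 unfolding w v
        by (simp add: s den_def)
    next
      case 2
      then have s: "nb k = 0" "nc k = k" "nd k = 0" "ne k = 0" for k using tot[of k] by auto
      have w: "w k = (a/c)^k" for k by (simp add: w_def s weight_def)
      have v: "v k = den1 q a c k (Suc k) / den1 q a c k k" for k
        by (simp add: v_def s den_def) (simp add: den1_def)
      show ?thesis using summable_powers[OF q nz _ h(2,3) H(1), of a c] D t0 unfolding w v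
        by (simp add: s den_def)
    next
      case 3
      then have s: "nb k = 0" "nc k = 0" "nd k = k" "ne k = 0" for k using tot[of k] by auto
      have w: "w k = (a/d)^k" for k by (simp add: w_def s weight_def)
      have v: "v k = den1 q a d k (Suc k) / den1 q a d k k" for k
        by (simp add: v_def s den_def) (simp add: den1_def)
      show ?thesis using summable_powers[OF q nz _ h(2,3) H(1), of a d] D t0 unfolding w v
        by (simp add: s den_def)
    next
      case 4
      then have s: "nb k = 0" "nc k = 0" "nd k = 0" "ne k = k" for k using tot[of k] by auto
      have w: "w k = (a/e)^k" for k by (simp add: w_def s weight_def)
      have v: "v k = den1 q a e k (Suc k) / den1 q a e k k" for k
        by (simp add: v_def s den_def) (simp add: den1_def)
      show ?thesis using summable_powers[OF q nz _ h(2,3) H(1), of a e] D t0 unfolding w v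
        by (simp add: s den_def)
    qed
  qed
  show ?thesis
  proof (rule summable_comparison_test')
    show "summable (\<lambda>k. norm (w k) * K)" by (intro summable_mult2 sw)
    show "norm (norm (t k)) \<le> norm (w k) * K" if "0 \<le> k" for k
      using mult_left_mono[OF K[of k] norm_ge_zero[of "w k"]] by (simp add: t norm_mult mult.assoc)
  qed
qed

section \<open>Growth of the index sequences\<close>

text \<open>If \<open>x = L\<close>, then \<open>tot\<close> at \<open>0\<close> forces
  \<open>ex div L = 0\<close>, and the bracket is the identity. Otherwise another step size is
  positive, and its bracket, which is at least \<open>k div L\<close>, bounds the gap from
  below.\<close>

lemma bracket_dichotomy:
  fixes k :: nat
  assumes L: "L = x + y + z + w" "1 \<le> L"
    and tot: "\<And>n. n = bracket ex x L n + bracket ey y L n + bracket ez z L n + bracket ew w L n"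
  shows "filterlim (\<lambda>k. k - bracket ex x L k) at_top sequentially \<or> (\<forall>k. bracket ex x L k = k)"
proof (cases "x = L")
  case True
  then have "bracket ex x L k = k" for k
    using tot[of 0] L(2) by (simp add: bracket_def div_mult_self1)
  then show ?thesis by simp
next
  case False
  have low: "k div L \<le> bracket e r L k" if "1 \<le> r" for r k e
    unfolding bracket_def using that by (intro div_le_mono) (cases r; simp)
  have "k div L \<le> k - bracket ex x L k" for k
  proof -
    have "1 \<le> y \<or> 1 \<le> z \<or> 1 \<le> w" using False L(1) by arith
    then have "k div L \<le> bracket ey y L k \<or> k div L \<le> bracket ez z L k \<or> k div L \<le> bracket ew w L k"
      using low by blast
    then show ?thesis using tot[of k] by linarith
  qed
  moreover have "filterlim (\<lambda>k. k div L) at_top sequentially"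
    using L(2) by (intro filterlim_at_top_div_const_nat) simp
  ultimately show ?thesis by (intro disjI1) (rule filterlim_at_top_mono, auto)
qed

lemma bracket_mono: "bracket ep lam L k \<le> bracket ep lam L (Suc k)"
  unfolding bracket_def by (intro div_le_mono) simp

section \<open>Identification of the series and regrouping into blocks of length \<Lambda>\<close>

theorem theorem3:
  fixes q a b c d :: complex
    and ep_b ep_c ep_d ep_e lam_b lam_c lam_d lam_e \<Lambda> \<delta> :: nat
    and nb nc nd ne :: "nat \<Rightarrow> nat"
    and \<phi> :: "complex \<Rightarrow> nat \<Rightarrow> complex"
    and H \<Theta> :: "nat \<Rightarrow> complex"
  defines "\<Lambda> \<equiv> lam_b + lam_c + lam_d + lam_e"
  defines "nb \<equiv> bracket ep_b lam_b \<Lambda>"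
    and "nc \<equiv> bracket ep_c lam_c \<Lambda>"
    and "nd \<equiv> bracket ep_d lam_d \<Lambda>"
    and "ne \<equiv> bracket ep_e lam_e \<Lambda>"
  defines "\<phi> \<equiv> phi q a b c d nb nc nd ne"
    and "H \<equiv> H_fun q a b c d nb nc nd ne"
    and "\<Theta> \<equiv> Theta q a b c d nb nc nd ne"
  assumes q: "0 < norm q" "norm q < 1"
    and nonzero: "a \<noteq> 0" "b \<noteq> 0" "c \<noteq> 0" "d \<noteq> 0"
    and Lambda: "1 \<le> \<Lambda>"
    and split: "\<And>n. n = nb n + nc n + nd n + ne n"
    and phi_nz: "\<And>n k. k \<le> n + 1 \<Longrightarrow> \<phi> (q ^ n) k \<noteq> 0"
    and denom_nz: "qpoch_inf q (q * a / b) \<noteq> 0" "qpoch_inf q (q * a / c) \<noteq> 0"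
      "qpoch_inf q (q * a / d) \<noteq> 0" "qpoch_inf q (b * c * d / a) \<noteq> 0"
    and H_nz: "\<And>n. H (n * \<Lambda>) \<noteq> 0"
    and conv: "summable (\<lambda>k. \<Theta> (k + 1) * (\<phi> (q ^ k) (k + 1) / (- \<phi> (q ^ k) k)) * H k)"
    and delta: "\<delta> < \<Lambda>"
  shows "qpoch_inf q b * qpoch_inf q c * qpoch_inf q d * qpoch_inf q (q * a\<^sup>2 / (b * c * d))
      / (qpoch_inf q (q * a / b) * qpoch_inf q (q * a / c) * qpoch_inf q (q * a / d)
          * qpoch_inf q (b * c * d / a))
    = (\<Sum>k<\<delta>. \<Theta> (k + 1) * (\<phi> (q ^ k) (k + 1) / (- \<phi> (q ^ k) k)) * H k)
      + (\<Sum>n. H (n * \<Lambda>) * \<Theta> (n * \<Lambda>)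
          * (\<Sum>i\<in>{\<delta>..<\<delta> + \<Lambda>}.
               \<Theta> (1 + i + n * \<Lambda>) / \<Theta> (n * \<Lambda>)
               * (\<phi> (q ^ (i + n * \<Lambda>)) (1 + i + n * \<Lambda>)
                    / (- \<phi> (q ^ (i + n * \<Lambda>)) (i + n * \<Lambda>)))
               * (H (i + n * \<Lambda>) / H (n * \<Lambda>))))"
proof -
  define e where "e = q*a\<^sup>2/(b*c*d)"
  have q0: "q \<noteq> 0" using q(1) by auto
  have e0: "e \<noteq> 0" using q0 nonzero by (simp add: e_def)
  have bal: "b*c*d*e = q*a\<^sup>2" using nonzero by (simp add: e_def)
  have qae: "q*a/e = b*c*d/a" using q0 nonzero by (simp add: e_def power2_eq_square)
  have tot: "nb k + nc k + nd k + ne k = k" for k using split[of k] by simp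
  have mon: "nb k \<le> nb (Suc k)" "nc k \<le> nc (Suc k)" "nd k \<le> nd (Suc k)" "ne k \<le> ne (Suc k)" for k
    unfolding nb_def nc_def nd_def ne_def by (rule bracket_mono)+
  have dich: "filterlim (\<lambda>k. k - nb k) at_top sequentially \<or> (\<forall>k. nb k = k)"
      "filterlim (\<lambda>k. k - nc k) at_top sequentially \<or> (\<forall>k. nc k = k)"
      "filterlim (\<lambda>k. k - nd k) at_top sequentially \<or> (\<forall>k. nd k = k)"
      "filterlim (\<lambda>k. k - ne k) at_top sequentially \<or> (\<forall>k. ne k = k)"
    unfolding nb_def nc_def nd_def ne_def
    by (rule bracket_dichotomy[of _ lam_b lam_c lam_d lam_e ep_b ep_c ep_d ep_e]
          bracket_dichotomy[of _ lam_c lam_b lam_d lam_e ep_c ep_b ep_d ep_e]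
          bracket_dichotomy[of _ lam_d lam_b lam_c lam_e ep_d ep_b ep_c ep_e]
          bracket_dichotomy[of _ lam_e lam_b lam_c lam_d ep_e ep_b ep_c ep_d];
        use Lambda tot in \<open>simp add: \<Lambda>_def nb_def nc_def nd_def ne_def add_ac\<close>)+
  define S where "S n k = pair_scale q a b n (nb k) * pair_scale q a c n (nc k) * pair_scale q a d n (nd k) * pair_scale q a e n (ne k)" for n k
  have phi: "\<phi> (q^n) k = den q a b c d e n (nb k) (nc k) (nd k) (ne k) * S n k" for n k
    unfolding \<phi>_def S_def e_def by (rule phi_den[OF q0 nonzero])
  have D: "den q a b c d e n (nb k) (nc k) (nd k) (ne k) \<noteq> 0" if "k \<le> Suc n" for n k
    using phi_nz[of k n] that unfolding phi by simp
  define t where "t = (\<lambda>k. coef q a b c d e (nb k) (nc k) (nd k) (ne k)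
     * (den q a b c d e k (nb (Suc k)) (nc (Suc k)) (nd (Suc k)) (ne (Suc k))
        / den q a b c d e k (nb k) (nc k) (nd k) (ne k)))"
  have Th: "\<Theta> k = weight q a b c d e (nb k) (nc k) (nd k) (ne k)" for k
    unfolding \<Theta>_def e_def by (rule Theta_weight[where nb=nb and nc=nc and nd=nd and ne=ne, OF nonzero(1) q0 tot])
  have Hh: "H k = hyper q a b c d e (nb k) (nc k) (nd k) (ne k)" for k
    unfolding H_def e_def by (rule H_hyper[where nb=nb and nc=nc and nd=nd and ne=ne, OF q0 nonzero tot])
  have term_eq: "\<Theta> (k + 1) * (\<phi> (q ^ k) (k + 1) / (- \<phi> (q ^ k) k)) * H k = t k" for k
  proof -
    have S0: "S k k \<noteq> 0" unfolding S_def using pair_scale_nonzero q0 nonzero e0 by simp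
    \<comment> \<open>A step in direction \<open>b\<close> multiplies \<open>\<Theta>\<close> by
      \<open>(a/b) * q^(k - nb k)\<close> and \<open>S k\<close> by
      \<open>- (b/a) * q^(nb k) / q^k\<close>, in total by \<open>-1\<close>; the other directions
      behave alike. This absorbs the minus sign of the statement and turns
      \<open>\<Theta> (k + 1)\<close> into \<open>\<Theta> k\<close>.\<close>
    have "\<Theta> (Suc k) * S k (Suc k) = - \<Theta> k * S k k"
    proof -
      have qk: "q^k = q^(nb k) * q^(nc k) * q^(nd k) * q^(ne k)"
        unfolding power_add[symmetric] tot ..
      have l: "w * (a/x*r) * (y1 * (- (x/a) * (u/q^k)) * y2 * y3 * y4) = - w * (y1*y2*y3*y4)"
        if "r*u = q^k" "x \<noteq> 0" for w x r u y1 y2 y3 y4 :: complex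
        using that q0 nonzero(1) by (simp add: field_simps) (simp flip: that)?
      consider "nb (Suc k) = Suc (nb k)" "nc (Suc k) = nc k" "nd (Suc k) = nd k" "ne (Suc k) = ne k"
        | "nb (Suc k) = nb k" "nc (Suc k) = Suc (nc k)" "nd (Suc k) = nd k" "ne (Suc k) = ne k"
        | "nb (Suc k) = nb k" "nc (Suc k) = nc k" "nd (Suc k) = Suc (nd k)" "ne (Suc k) = ne k"
        | "nb (Suc k) = nb k" "nc (Suc k) = nc k" "nd (Suc k) = nd k" "ne (Suc k) = Suc (ne k)"
        using tot[of k] tot[of "Suc k"] mon[of k] by linarith
      then show ?thesis
      proof cases
        case 1
        show ?thesis unfolding Th S_def 1 weight_Suc pair_scale_Suc
          by (rule l) (use nonzero in \<open>simp_all add: qk power_add\<close>)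
      next
        case 2
        show ?thesis unfolding Th S_def 2 weight_Suc pair_scale_Suc
          using l[of "q^(nb k + nd k + ne k)" "q^nc k" c "weight q a b c d e (nb k) (nc k) (nd k) (ne k)"
             "pair_scale q a c k (nc k)" "pair_scale q a b k (nb k)" "pair_scale q a d k (nd k)" "pair_scale q a e k (ne k)"] nonzero
          by (simp add: qk power_add mult_ac)
      next
        case 3
        show ?thesis unfolding Th S_def 3 weight_Suc pair_scale_Suc
          using l[of "q^(nb k + nc k + ne k)" "q^nd k" d "weight q a b c d e (nb k) (nc k) (nd k) (ne k)"
             "pair_scale q a d k (nd k)" "pair_scale q a b k (nb k)" "pair_scale q a c k (nc k)" "pair_scale q a e k (ne k)"] nonzero
          by (simp add: qk power_add mult_ac)
      next
        case 4
        show ?thesis unfolding Th S_def 4 weight_Suc pair_scale_Suc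
          using l[of "q^(nb k + nc k + nd k)" "q^ne k" e "weight q a b c d e (nb k) (nc k) (nd k) (ne k)"
             "pair_scale q a e k (ne k)" "pair_scale q a b k (nb k)" "pair_scale q a c k (nc k)" "pair_scale q a d k (nd k)"] e0
          by (simp add: qk power_add mult_ac)
      qed
    qed
    then have "\<Theta> (Suc k) * S k (Suc k) / (- S k k) = \<Theta> k" using S0 by (simp add: field_simps)
    moreover have "\<Theta> (k + 1) * (\<phi> (q ^ k) (k + 1) / (- \<phi> (q ^ k) k)) * H k
      = (\<Theta> (Suc k) * S k (Suc k) / (- S k k)) * H k
       * (den q a b c d e k (nb (Suc k)) (nc (Suc k)) (nd (Suc k)) (ne (Suc k))
        / den q a b c d e k (nb k) (nc k) (nd k) (ne k))"
      unfolding phi by (simp add: mult_ac)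
    ultimately show ?thesis unfolding t_def coef_def Th[symmetric] Hh[symmetric] by simp
  qed
  have sm: "summable t" using conv unfolding term_eq .
  have nsm: "summable (\<lambda>k. norm (t k))"
    unfolding t_def
    by (rule summable_norm_term[OF q0 q(2) tot mon dich D Lambda]) (use H_nz Hh sm[unfolded t_def] in auto)
  have "(\<Sum>k. t k) = (qpoch_inf q b * qpoch_inf q c * qpoch_inf q d * qpoch_inf q e)
      / (qpoch_inf q (q*a/b) * qpoch_inf q (q*a/c) * qpoch_inf q (q*a/d) * qpoch_inf q (q*a/e))"
    unfolding t_def
    by (rule nonterminating_sum[OF q0 nonzero e0 bal q(2) denom_nz(1-3) _ tot mon D])
      (use denom_nz(4) qae nsm[unfolded t_def] in auto)
  moreover have "(\<Sum>k. t k) = (\<Sum>k<\<delta>. t k) + (\<Sum>n. \<Sum>i\<in>{\<delta>..<\<delta>+\<Lambda>}. t (i + n*\<Lambda>))"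
  proof -
    \<comment> \<open>The first \<delta> terms are split off, the shifted series is grouped into
      blocks of length \<Lambda>, and each block is reindexed to start at \<delta>.\<close>
    have "(\<lambda>k. t (k + \<delta>)) sums (\<Sum>k. t (k + \<delta>))"
      using sm by (intro summable_sums) (simp add: summable_iff_shift)
    from sums_group[OF this, of \<Lambda>] Lambda
    have "(\<lambda>n. \<Sum>k\<in>{n*\<Lambda>..<n*\<Lambda>+\<Lambda>}. t (k + \<delta>)) sums (\<Sum>k. t (k + \<delta>))" by simp
    moreover have "(\<Sum>k\<in>{n*\<Lambda>..<n*\<Lambda>+\<Lambda>}. t (k + \<delta>)) = (\<Sum>i\<in>{\<delta>..<\<delta>+\<Lambda>}. t (i + n*\<Lambda>))" for n
      by (rule sum.reindex_bij_witness[of _ "\<lambda>i. i - \<delta> + n*\<Lambda>" "\<lambda>k. k + \<delta> - n*\<Lambda>"]) auto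
    ultimately have "(\<Sum>n. \<Sum>i\<in>{\<delta>..<\<delta>+\<Lambda>}. t (i + n*\<Lambda>)) = (\<Sum>k. t (k + \<delta>))"
      by (simp add: sums_iff)
    then show ?thesis using suminf_split_initial_segment[OF sm, of \<delta>] by simp
  qed
  moreover have "H (n * \<Lambda>) * \<Theta> (n * \<Lambda>)
          * (\<Sum>i\<in>{\<delta>..<\<delta> + \<Lambda>}.
               \<Theta> (1 + i + n * \<Lambda>) / \<Theta> (n * \<Lambda>)
               * (\<phi> (q ^ (i + n * \<Lambda>)) (1 + i + n * \<Lambda>)
                    / (- \<phi> (q ^ (i + n * \<Lambda>)) (i + n * \<Lambda>)))
               * (H (i + n * \<Lambda>) / H (n * \<Lambda>)))
      = (\<Sum>i\<in>{\<delta>..<\<delta>+\<Lambda>}. t (i + n*\<Lambda>))" for n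
  proof -
    \<comment> \<open>\<Theta> is a product of powers of nonzero numbers; together with
      \<open>H_nz\<close> this lets both prefactors cancel against the quotients inside the inner
      sum.\<close>
    have Th0: "\<Theta> (n * \<Lambda>) \<noteq> 0" unfolding Th weight_def using q0 nonzero e0 by simp
    have "u * w * (x / w * y * (z / u)) = x * y * z" if "u \<noteq> 0" "w \<noteq> 0" for u w x y z :: complex
      using that by simp
    note cancel = this[OF H_nz[of n] Th0]
    show ?thesis unfolding sum_distrib_left cancel
      using term_eq by (intro sum.cong) (simp_all add: add_ac)
  qed
  ultimately show ?thesis unfolding term_eq qae[symmetric] e_def[symmetric]
    by simp
qed

end
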